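(* Let $m\geq 2$ and let $\alpha_m$ be the unique real number $\alpha>1$ with $f_m(\alpha)=1$, where $$f_m(\alpha) = (\alpha-1)\bigl(H_{m-1}-H_{\lceil(1-1/\alpha)m\rceil-1}\bigr) + \lceil(1-1/\alpha)m\rceil\, \alpha/m .$$ Then the algorithm ALG($\alpha_m$) described in the context is $\alpha_m$-competitive: for every job sequence $\sigma$, the makespan of the final schedule it produces is at most $\alpha_m\cdot \mathrm{OPT}(\sigma)$, where $\mathrm{OPT}(\sigma)$ is the optimum (offline, non-preemptive) makespan of $\sigma$ on $m$ identical machines. Moreover, ALG($\alpha_m$) uses at most $(\lceil (2-\alpha_m)/(\alpha_m-1)^2\rceil+4)m$ job migrations (i.e. removes and reassigns at most that many jobs). This holds for any way of breaking ties and any choice among admissible machines.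
   Context: Problem: a sequence $\sigma=J_1,\dots,J_n$ of jobs with processing times $p_1,\dots,p_n>0$ arrives online and must be scheduled non-preemptively on $m$ identical machines $M_1,\dots,M_m$; each job is assigned to a machine immediately on arrival without knowledge of future jobs. A migration is the removal of an already assigned job from its machine and its reassignment to some machine. The makespan is the maximum machine load (sum of processing times of jobs on the machine) in the final schedule. $H_k=\sum_{i=1}^k 1/i$, $H_0=0$. Notation: $p_t^+=\sum_{i=1}^t p_i$; for $1\le i\le 2m+1$, $p_t^i$ is the $i$-th largest processing time among $J_1,\dots,J_t$ if $i\le t$, and $0$ otherwise. $L_t=\max\{p_t^+/m,\ 3p_t^{2m+1}\}$. A job $J_i$ with $i\le t$ is small at time $t$ if $p_i\le(\alpha_m-1)L_t$, large at time $t$ otherwise; $J_t$ is small if it is small at time $t$. For $i=1,\dots,2m$, $\hat p_t^i=p_t^i$ if $p_t^i>(\alpha_m-1)L_t$ and $\hat p_t^i=0$ otherwise; $L_t^*=\frac1m(p_t^+-\sum_{i=1}^{2m}\hat p_t^i)$. For $1\le j\le m$, $\beta(j)=(\alpha_m-1)\frac{m}{m-j}$ if $j\le\lfloor m/\alpha_m\rfloor$ and $\beta(j)=\alpha_m$ otherwise. $\ell(j,t)$ is the load of $M_j$ just before $J_t$ is assigned, and $\ell_s(j,t)$ is the load of $M_j$ just before $J_t$ is assigned counting only jobs that are small at time $t$. Algorithm ALG($\alpha_m$). Job arrival phase (no migrations): for $t=1,\dots,n$: if $J_t$ is small, assign it to a machine $M_j$ with $\ell_s(j,t)\le\beta(j)L_t^*$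 (such a machine always exists); if $J_t$ is large, assign it to a machine of least current load. Let $L=L_n$, $L^*=L_n^*$. Job migration phase, performed after all jobs have arrived, with $\ell(j)$ the current load of $M_j$: (removal) set $R=\emptyset$; while some $M_j$ has $\ell(j)>\max\{\beta(j)L^*,(\alpha_m-1)L\}$, remove the largest job on $M_j$ and add it to $R$. If $R=\emptyset$ stop. (Reassignment) let $R'=\{J_i\in R: p_i>(\alpha_m-1)L\}$, sorted by non-increasing processing time as $J_r^1,J_r^2,\dots$ with processing times $p_r^1\ge p_r^2\ge\cdots$. For $i=1,\dots,m$ form a set $P_i$ containing $J_r^i$ if $i\le|R'|$, and also $J_r^{2m+1-i}$ if $2m+1-i\le|R'|$ and $p_r^{2m+1-i}>p_r^i/2$. Renumber these sets so that their total processing times are non-increasing; for $i=1,\dots,m$ assign all jobs of $P_i$ together to a machine of currently least load. Finally assign each job of $R\setminus(P_1\cup\dots\cup P_m)$, in arbitrary order, to a machine of currently least load. *)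

theory Defs
  imports "HOL-Analysis.Harmonic_Numbers" "HOL-Library.Multiset"
begin

text \<open>
  Jobs are numbered \<open>1, \<dots>, n\<close> and \<open>p i\<close> is the processing time of job \<open>i\<close>; the machines
  are \<open>1, \<dots>, m\<close>. A (partial) schedule maps each currently assigned job to its machine.
\<close>

type_synonym schedule = "nat \<Rightarrow> nat option"

definition load :: "(nat \<Rightarrow> real) \<Rightarrow> schedule \<Rightarrow> nat \<Rightarrow> real" where
  "load p S j = (\<Sum>i | S i = Some j. p i)"

definition makespan :: "nat \<Rightarrow> (nat \<Rightarrow> real) \<Rightarrow> schedule \<Rightarrow> real" where
  "makespan m p S = Max (load p S ` {1..m})"

definition complete_schedules :: "nat \<Rightarrow> nat \<Rightarrow> schedule set" where
  "complete_schedules m n = {S. dom S = {1..n} \<and> ran S \<subseteq> {1..m}}"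

definition OPT :: "nat \<Rightarrow> (nat \<Rightarrow> real) \<Rightarrow> nat \<Rightarrow> real" where
  "OPT m p n = Min (makespan m p ` complete_schedules m n)"

definition f_comp :: "nat \<Rightarrow> real \<Rightarrow> real" where
  "f_comp m \<alpha> =
     (\<alpha> - 1) * (harm (m - 1) - harm (nat \<lceil>(1 - 1 / \<alpha>) * real m\<rceil> - 1))
     + real_of_int \<lceil>(1 - 1 / \<alpha>) * real m\<rceil> * \<alpha> / real m"

definition alpha :: "nat \<Rightarrow> real" where
  "alpha m = (THE \<alpha>. \<alpha> > 1 \<and> f_comp m \<alpha> = 1)"

definition p_plus :: "(nat \<Rightarrow> real) \<Rightarrow> nat \<Rightarrow> real" where
  "p_plus p t = (\<Sum>i=1..t. p i)"

text \<open>The \<open>i\<close>-th largest of \<open>p 1, \<dots>, p t\<close>, counted with multiplicity; used for \<open>i \<ge> 1\<close> only.\<close>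

definition p_largest :: "(nat \<Rightarrow> real) \<Rightarrow> nat \<Rightarrow> nat \<Rightarrow> real" where
  "p_largest p t i = (if i \<le> t then rev (sort (map p [1..<Suc t])) ! (i - 1) else 0)"

definition L_bound :: "nat \<Rightarrow> (nat \<Rightarrow> real) \<Rightarrow> nat \<Rightarrow> real" where
  "L_bound m p t = max (p_plus p t / real m) (3 * p_largest p t (2 * m + 1))"

definition small_at :: "nat \<Rightarrow> real \<Rightarrow> (nat \<Rightarrow> real) \<Rightarrow> nat \<Rightarrow> nat \<Rightarrow> bool" where
  "small_at m \<alpha> p t i \<longleftrightarrow> p i \<le> (\<alpha> - 1) * L_bound m p t"

definition p_hat :: "nat \<Rightarrow> real \<Rightarrow> (nat \<Rightarrow> real) \<Rightarrow> nat \<Rightarrow> nat \<Rightarrow> real" where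
  "p_hat m \<alpha> p t i =
     (if p_largest p t i > (\<alpha> - 1) * L_bound m p t then p_largest p t i else 0)"

definition L_star :: "nat \<Rightarrow> real \<Rightarrow> (nat \<Rightarrow> real) \<Rightarrow> nat \<Rightarrow> real" where
  "L_star m \<alpha> p t = 1 / real m * (p_plus p t - (\<Sum>i=1..2*m. p_hat m \<alpha> p t i))"

definition beta :: "nat \<Rightarrow> real \<Rightarrow> nat \<Rightarrow> real" where
  "beta m \<alpha> j =
     (if int j \<le> \<lfloor>real m / \<alpha>\<rfloor> then (\<alpha> - 1) * (real m / (real m - real j)) else \<alpha>)"

definition small_load :: "nat \<Rightarrow> real \<Rightarrow> (nat \<Rightarrow> real) \<Rightarrow> schedule \<Rightarrow> nat \<Rightarrow> nat \<Rightarrow> real" where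
  "small_load m \<alpha> p S j t = (\<Sum>i | S i = Some j \<and> small_at m \<alpha> p t i. p i)"

definition least_loaded :: "nat \<Rightarrow> (nat \<Rightarrow> real) \<Rightarrow> schedule \<Rightarrow> nat \<Rightarrow> bool" where
  "least_loaded m p S j \<longleftrightarrow> j \<in> {1..m} \<and> (\<forall>k\<in>{1..m}. load p S j \<le> load p S k)"

definition admissible :: "nat \<Rightarrow> real \<Rightarrow> (nat \<Rightarrow> real) \<Rightarrow> schedule \<Rightarrow> nat \<Rightarrow> nat \<Rightarrow> bool" where
  "admissible m \<alpha> p S t j \<longleftrightarrow>
     j \<in> {1..m} \<and> small_load m \<alpha> p S j t \<le> beta m \<alpha> j * L_star m \<alpha> p t"

text \<open>
  The algorithm is nondeterministic (ties, choice among admissible machines, order of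
  processing), so each phase is a relation that holds for all its possible outcomes.
  \<open>arrival m \<alpha> p t S\<close>: \<open>S\<close> is a possible schedule right after job \<open>t\<close> has been assigned.
\<close>

inductive arrival :: "nat \<Rightarrow> real \<Rightarrow> (nat \<Rightarrow> real) \<Rightarrow> nat \<Rightarrow> schedule \<Rightarrow> bool"
  for m \<alpha> p where
  arrival_init: "arrival m \<alpha> p 0 Map.empty"
| arrival_small:
    "arrival m \<alpha> p t S \<Longrightarrow> small_at m \<alpha> p (Suc t) (Suc t)
     \<Longrightarrow> admissible m \<alpha> p S (Suc t) j
     \<Longrightarrow> arrival m \<alpha> p (Suc t) (S(Suc t \<mapsto> j))"
| arrival_large:
    "arrival m \<alpha> p t S \<Longrightarrow> \<not> small_at m \<alpha> p (Suc t) (Suc t)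
     \<Longrightarrow> least_loaded m p S j
     \<Longrightarrow> arrival m \<alpha> p (Suc t) (S(Suc t \<mapsto> j))"

definition exceeds :: "nat \<Rightarrow> real \<Rightarrow> (nat \<Rightarrow> real) \<Rightarrow> nat \<Rightarrow> schedule \<Rightarrow> nat \<Rightarrow> bool" where
  "exceeds m \<alpha> p n S j \<longleftrightarrow> j \<in> {1..m} \<and>
     load p S j > max (beta m \<alpha> j * L_star m \<alpha> p n) ((\<alpha> - 1) * L_bound m p n)"

text \<open>
  \<open>removal m \<alpha> p n S\<^sub>0 S R\<close>: starting from \<open>S\<^sub>0\<close>, the removal loop can reach the schedule \<open>S\<close>
  with set \<open>R\<close> of removed jobs, not necessarily having finished.
\<close>

inductive removal ::
    "nat \<Rightarrow> real \<Rightarrow> (nat \<Rightarrow> real) \<Rightarrow> nat \<Rightarrow> schedule \<Rightarrow> schedule \<Rightarrow> nat set \<Rightarrow> bool"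
  for m \<alpha> p n S\<^sub>0 where
  removal_init: "removal m \<alpha> p n S\<^sub>0 S\<^sub>0 {}"
| removal_step:
    "removal m \<alpha> p n S\<^sub>0 S R \<Longrightarrow> exceeds m \<alpha> p n S j
     \<Longrightarrow> S i = Some j \<Longrightarrow> (\<forall>k. S k = Some j \<longrightarrow> p k \<le> p i)
     \<Longrightarrow> removal m \<alpha> p n S\<^sub>0 (S(i := None)) (insert i R)"

text \<open>The set \<open>P\<^sub>i\<close>, where \<open>rs\<close> lists \<open>R'\<close>; the list is indexed from 0, so \<open>J\<^sub>r\<^sup>k\<close> is \<open>rs ! (k - 1)\<close>.\<close>

definition pair_set :: "nat \<Rightarrow> (nat \<Rightarrow> real) \<Rightarrow> nat list \<Rightarrow> nat \<Rightarrow> nat set" where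
  "pair_set m p rs i =
     (if i \<le> length rs then {rs ! (i - 1)} else {}) \<union>
     (if 2 * m + 1 - i \<le> length rs \<and> p (rs ! (2 * m + 1 - i - 1)) > p (rs ! (i - 1)) / 2
      then {rs ! (2 * m + 1 - i - 1)} else {})"

definition assign_set :: "nat set \<Rightarrow> nat \<Rightarrow> schedule \<Rightarrow> schedule" where
  "assign_set B j S = (\<lambda>i. if i \<in> B then Some j else S i)"

inductive greedy ::
    "nat \<Rightarrow> (nat \<Rightarrow> real) \<Rightarrow> nat set list \<Rightarrow> schedule \<Rightarrow> schedule \<Rightarrow> bool"
  for m p where
  greedy_Nil: "greedy m p [] S S"
| greedy_Cons:
    "least_loaded m p S j \<Longrightarrow> greedy m p Bs (assign_set B j S) S'
     \<Longrightarrow> greedy m p (B # Bs) S S'"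

definition reassignment ::
    "nat \<Rightarrow> real \<Rightarrow> (nat \<Rightarrow> real) \<Rightarrow> nat \<Rightarrow> nat set \<Rightarrow> schedule \<Rightarrow> schedule \<Rightarrow> bool" where
  "reassignment m \<alpha> p n R S S' \<longleftrightarrow>
     (\<exists>rs Ps qs S\<^sub>P.
        distinct rs \<and> set rs = {i \<in> R. p i > (\<alpha> - 1) * L_bound m p n} \<and>
        sorted_wrt (\<lambda>x y. p x \<ge> p y) rs \<and>
        mset Ps = mset (map (pair_set m p rs) [1..<Suc m]) \<and>
        sorted_wrt (\<lambda>A B. sum p A \<ge> sum p B) Ps \<and>
        greedy m p Ps S S\<^sub>P \<and>
        distinct qs \<and> set qs = R - (\<Union>i\<in>{1..m}. pair_set m p rs i) \<and>
        greedy m p (map (\<lambda>i. {i}) qs) S\<^sub>P S')"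

text \<open>
  \<open>ALG m \<alpha> p n S R\<close>: on the job sequence \<open>p 1, \<dots>, p n\<close> the algorithm can produce the final
  schedule \<open>S\<close> while migrating exactly the jobs in \<open>R\<close>. As no job is removed twice and all of \<open>R\<close>
  is reassigned, \<open>card R\<close> is the number of migrations. If \<open>R = {}\<close>, the
  reassignment leaves the schedule unchanged.
\<close>

definition ALG ::
    "nat \<Rightarrow> real \<Rightarrow> (nat \<Rightarrow> real) \<Rightarrow> nat \<Rightarrow> schedule \<Rightarrow> nat set \<Rightarrow> bool" where
  "ALG m \<alpha> p n S R \<longleftrightarrow>
     (\<exists>S\<^sub>0 S\<^sub>1. arrival m \<alpha> p n S\<^sub>0 \<and>
        removal m \<alpha> p n S\<^sub>0 S\<^sub>1 R \<and> (\<forall>j. \<not> exceeds m \<alpha> p n S\<^sub>1 j) \<and>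
        reassignment m \<alpha> p n R S\<^sub>1 S)"

end

theory Submission imports Defs begin

text \<open>
  The average of \<open>beta m \<alpha> 1, \<dots>, beta m \<alpha> m\<close> is \<open>f_comp m \<alpha>\<close>, and each \<open>beta m \<alpha> j\<close> is
  \<open>\<alpha>\<close> capped by \<open>(\<alpha> - 1) * m / (m - j)\<close>. So \<open>f_comp m\<close> is continuous and strictly increasing, its
  value 1 is taken between \<open>4/3\<close> and \<open>3/2\<close>, and an admissible machine exists by averaging.

  Competitiveness: as \<open>\<alpha> \<ge> 4/3\<close>, at most \<open>2 * m\<close> jobs are large, and a pigeonhole argument bounds
  every set \<open>P\<^sub>i\<close> by \<open>OPT\<close> and every unpaired job by \<open>OPT / 3\<close>. When the \<open>k\<close>-th set, of total
  \<open>x\<close>, is placed, some machine \<open>j \<le> k\<close> has received no set, while \<open>L\<^sup>* \<le> OPT - k * x / m\<close>; the choice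
  of \<open>beta\<close> then gives load at most \<open>\<alpha> * OPT\<close>.

  Migrations: removing largest jobs first is optimal, so it suffices to exhibit on every machine a
  small set of jobs whose removal is enough. Apart from at most four of its jobs, these can be chosen
  of size at least \<open>(\<alpha> - 1)\<^sup>2 * L\<close>, and a machine whose last job arrived as a large one had load
  at most \<open>L\<close> before it. The condition \<open>\<alpha> \<le> 3/2\<close> saves one removal in the only case where a fifth
  job would be needed.
\<close>

section \<open>The competitive ratio\<close>

text \<open>Putting i = m - j in the average of the \<open>beta m \<alpha> j\<close> makes floor and
  ceiling disappear, so continuity and monotonicity in \<alpha> can be read off termwise. Index 0 is
  separate because division by 0 yields 0.\<close>

definition mean_cap :: "nat \<Rightarrow> real \<Rightarrow> real" where
  "mean_cap m \<alpha> = (\<Sum>i<m. if i = 0 then \<alpha> else min \<alpha> ((\<alpha> - 1) * (real m / real i))) / real m"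

text \<open>For j < m the two branches of \<open>beta\<close> cross exactly at \<alpha> * j = m, so
  the floor condition always selects the smaller one.\<close>

lemma beta_eq_min:
  assumes "\<alpha> > 1" "1 \<le> j" "j \<le> m"
  shows "beta m \<alpha> j = (if m - j = 0 then \<alpha> else min \<alpha> ((\<alpha> - 1) * (real m / real (m - j))))"
proof (cases "real j \<le> real m / \<alpha>")
  case True
  then have le: "\<alpha> * real j \<le> real m"
    using assms by (simp add: field_simps)
  have "1 * real j < \<alpha> * real j"
    using assms by (intro mult_strict_right_mono) auto
  with le have "j < m"
    by simp
  moreover have "(\<alpha> - 1) * (real m / real (m - j)) \<le> \<alpha>"
    using le \<open>j < m\<close> by (simp add: field_simps of_nat_diff)
  moreover have "int j \<le> \<lfloor>real m / \<alpha>\<rfloor>"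
    using True by (simp add: le_floor_iff)
  ultimately show ?thesis
    by (simp add: beta_def of_nat_diff)
next
  case False
  then have gt: "\<alpha> * real j > real m"
    using assms by (simp add: field_simps)
  have "\<not> int j \<le> \<lfloor>real m / \<alpha>\<rfloor>"
    using False by (simp add: le_floor_iff)
  moreover have "\<alpha> \<le> (\<alpha> - 1) * (real m / real (m - j))" if "j < m"
    using gt that by (simp add: field_simps of_nat_diff)
  ultimately show ?thesis
    using assms by (auto simp: beta_def)
qed

lemma mean_cap_eq_beta:
  assumes "\<alpha> > 1"
  shows "mean_cap m \<alpha> = (\<Sum>j=1..m. beta m \<alpha> j) / real m"
proof -
  have "(\<Sum>j=1..m. beta m \<alpha> j)
      = (\<Sum>i<m. if i = 0 then \<alpha> else min \<alpha> ((\<alpha> - 1) * (real m / real i)))"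
    by (rule sum.reindex_bij_witness[where i = "\<lambda>i. m - i" and j = "\<lambda>j. m - j"])
       (use assms in \<open>auto simp: beta_eq_min\<close>)
  then show ?thesis
    by (simp add: mean_cap_def)
qed

lemma sum_inverse_diff_eq_harm:
  assumes "q < m"
  shows "(\<Sum>j=1..q. 1 / (real m - real j)) = harm (m - 1) - harm (m - q - 1)"
  using assms
proof (induction q)
  case (Suc q)
  then have "m - q - 1 = Suc (m - Suc q - 1)"
    by simp
  then have "harm (m - q - 1) = harm (m - Suc q - 1) + 1 / (real m - real (Suc q))"
    using Suc.prems by (simp add: harm_Suc inverse_eq_divide of_nat_diff)
  with Suc show ?case
    by simp
qed simp

text \<open>With q the floor of m / \<alpha>, the first q values of \<open>beta\<close> produce the
  harmonic difference. The other m - q all equal \<alpha>, and m - q is the ceiling in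
  \<open>f_comp\<close>.\<close>

lemma f_comp_eq_mean_cap:
  assumes "\<alpha> > 1" "m \<ge> 1"
  shows "f_comp m \<alpha> = mean_cap m \<alpha>"
proof -
  define q where "q = nat \<lfloor>real m / \<alpha>\<rfloor>"
  have fl: "\<lfloor>real m / \<alpha>\<rfloor> = int q"
    using assms by (simp add: q_def)
  have "real q \<le> real m / \<alpha>"
    using fl of_int_floor_le[of "real m / \<alpha>"] by simp
  also have "\<dots> < real m"
    using assms by (simp add: divide_simps)
  finally have "q < m"
    by simp
  have "(1 - 1 / \<alpha>) * real m = of_int (int m) + - (real m / \<alpha>)"
    by (simp add: field_simps)
  then have c: "\<lceil>(1 - 1 / \<alpha>) * real m\<rceil> = int m - int q"
    using fl ceiling_add_of_int[of "- (real m / \<alpha>)" "int m"]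
    by (simp add: ceiling_minus add.commute)
  have "(\<Sum>j=1..m. beta m \<alpha> j) = (\<Sum>j=1..q. beta m \<alpha> j) + (\<Sum>j=Suc q..m. beta m \<alpha> j)"
    using \<open>q < m\<close> sum.ub_add_nat[of 1 q "beta m \<alpha>" "m - q"] by simp
  also have "(\<Sum>j=Suc q..m. beta m \<alpha> j) = (\<Sum>j=Suc q..m. \<alpha>)"
    by (intro sum.cong) (auto simp: beta_def fl)
  also have "(\<Sum>j=1..q. beta m \<alpha> j) = (\<Sum>j=1..q. (\<alpha> - 1) * real m * (1 / (real m - real j)))"
    by (intro sum.cong) (auto simp: beta_def fl)
  also have "\<dots> = (\<alpha> - 1) * real m * (harm (m - 1) - harm (m - q - 1))"
    by (simp only: sum_distrib_left[symmetric] sum_inverse_diff_eq_harm[OF \<open>q < m\<close>])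
  finally have "(\<Sum>j=1..m. beta m \<alpha> j)
      = (\<alpha> - 1) * real m * (harm (m - 1) - harm (m - q - 1)) + (real m - real q) * \<alpha>"
    using \<open>q < m\<close> by (simp add: of_nat_diff)
  moreover have "nat (int m - int q) = m - q"
    by simp
  ultimately show ?thesis
    using assms unfolding mean_cap_eq_beta[OF assms(1)] f_comp_def c
    by (simp add: add_divide_distrib)
qed

text \<open>Each summand is non-decreasing in \<alpha>, and the one at index 0 is \<alpha>
  itself.\<close>

lemma mean_cap_strict_mono:
  assumes "1 < \<alpha>" "\<alpha> < \<alpha>'" "m \<ge> 1"
  shows "mean_cap m \<alpha> < mean_cap m \<alpha>'"
  unfolding mean_cap_def
proof (rule divide_strict_right_mono[OF sum_strict_mono_ex1])
  show "\<forall>i\<in>{..<m}. (if i = 0 then \<alpha> else min \<alpha> ((\<alpha> - 1) * (real m / real i)))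
      \<le> (if i = 0 then \<alpha>' else min \<alpha>' ((\<alpha>' - 1) * (real m / real i)))"
    using assms by (auto intro!: min.mono mult_right_mono simp del: times_divide_eq_right min.bounded_iff)
  show "\<exists>i\<in>{..<m}. (if i = 0 then \<alpha> else min \<alpha> ((\<alpha> - 1) * (real m / real i)))
      < (if i = 0 then \<alpha>' else min \<alpha>' ((\<alpha>' - 1) * (real m / real i)))"
    using assms by (intro bexI[of _ 0]) auto
qed (use assms in auto)

lemma continuous_on_mean_cap: "continuous_on A (mean_cap m)"
proof -
  have "continuous_on A (\<lambda>\<alpha>. if i = (0::nat) then \<alpha> else min \<alpha> ((\<alpha> - 1) * (real m / real i)))" for i
    by (cases "i = 0") (auto intro!: continuous_intros)
  then show ?thesis
    unfolding mean_cap_def divide_inverse by (auto intro!: continuous_intros)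
qed

section \<open>Location of the ratio between 4/3 and 3/2\<close>

text \<open>
  For \<open>m \<ge> 12\<close> the chord of \<open>x \<mapsto> 1 / (3 * x)\<close> between \<open>1/4\<close> and \<open>1\<close>, corrected at the
  three smallest indices, is a sufficient bound.
\<close>

lemma mean_cap_four_thirds_le:
  assumes "m \<ge> 2"
  shows "mean_cap m (4/3) \<le> 1"
proof (cases "m \<ge> 12")
  case True
  \<comment> \<open>At x = i / m the chord is 5/3 - 4 * x / 3. Its excess over 4/3 is subtracted for
    i \<le> 2, so \<open>c i\<close> is 4/3 there.\<close>
  define c where "c i = 5/3 - 4 * real i / (3 * real m) - (if i = 0 then 1/3 else 0)
    - (if i = 1 then 1/3 - 4 / (3 * real m) else 0) - (if i = 2 then 1/3 - 8 / (3 * real m) else 0)" for i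
  have "(if i = 0 then 4/3 else min (4/3) ((4/3 - 1) * (real m / real i))) \<le> c i" if "i < m" for i
  proof (cases "i \<le> 2")
    case True
    then have "i = 0 \<or> i = 1 \<or> i = 2"
      by auto
    then show ?thesis
      by (auto simp: c_def)
  next
    case False
    show ?thesis
    proof (cases "4 * i \<le> m")
      case True
      then have "4 * real i / (3 * real m) \<le> 1/3"
        using \<open>i < m\<close> by (simp add: field_simps)
      then have "4/3 \<le> c i"
        using False by (simp add: c_def)
      then show ?thesis
        using False by simp
    next
      case notle: False
      \<comment> \<open>The convex function lies below its chord between the nodes i = m / 4 and i =
        m; cleared of denominators this is the sign of the product.\<close>
      have "0 \<le> (4 * real i - real m) * (real m - real i)"
        using notle \<open>i < m\<close> by (intro mult_nonneg_nonneg) auto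
      then have "real m / (3 * real i) \<le> 5/3 - 4 * real i / (3 * real m)"
        using False \<open>i < m\<close> by (simp add: field_simps power2_eq_square)
      then show ?thesis
        using False by (simp add: c_def)
    qed
  qed
  then have "(\<Sum>i<m. if i = 0 then 4/3 else min (4/3) ((4/3 - 1) * (real m / real i))) \<le> (\<Sum>i<m. c i)"
    by (intro sum_mono) auto
  also have "(\<Sum>i<m. c i) = 5/3 * real m - 4 / (3 * real m) * (\<Sum>i<m. real i) - 1/3
      - (1/3 - 4 / (3 * real m)) - (1/3 - 8 / (3 * real m))"
    using True by (simp add: c_def sum_subtractf sum.delta sum_distrib_left)
  also have "(\<Sum>i<m. real i) = real m * (real m - 1) / 2"
    by (induction m) (auto simp: field_simps)
  also have "5/3 * real m - 4 / (3 * real m) * (real m * (real m - 1) / 2) - 1/3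
      - (1/3 - 4 / (3 * real m)) - (1/3 - 8 / (3 * real m)) = real m - 1/3 + 4 / real m"
    using True by (simp add: field_simps)
  \<comment> \<open>Needs 4 / m \<le> 1/3, which is where the bound 12 comes from.\<close>
  also have "\<dots> \<le> real m"
    using True by (simp add: field_simps)
  finally show ?thesis
    using True by (simp add: mean_cap_def)
next
  case False
  then have "m = 2 \<or> m = 3 \<or> m = 4 \<or> m = 5 \<or> m = 6 \<or> m = 7 \<or> m = 8 \<or> m = 9 \<or> m = 10 \<or> m = 11"
    using assms by arith
  then show ?thesis
    unfolding mean_cap_def
    by (elim disjE) (simp_all add: eval_nat_numeral min_def)
qed

text \<open>The right side is the sum of 1 / i for k \<le> i < m. Each term is at least ln (1 + 1 /
  i), and these logarithms telescope.\<close>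

lemma ln_le_harm_diff:
  assumes "1 \<le> k" "k \<le> m"
  shows "ln (real m / real k) \<le> harm (m - 1) - harm (k - 1)"
  using assms(2)
proof (induction m rule: dec_induct)
  case (step m)
  then have m: "m \<ge> 1"
    using assms by auto
  have "real (Suc m) / real k = real m / real k * (1 + 1 / real m)"
    using m by (simp add: distrib_left add_divide_distrib del: of_nat_Suc, simp add: add_divide_distrib)
  then have "ln (real (Suc m) / real k) = ln (real m / real k) + ln (1 + 1 / real m)"
    using m assms by (subst ln_mult_pos[symmetric]) (auto intro: add_pos_nonneg)
  also have "ln (1 + 1 / real m) \<le> 1 / real m"
    by (rule ln_add_one_self_le_self) simp
  also have "1 / real m = harm m - harm (m - 1)"
    using m harm_Suc[of "m - 1", where ?'a = real] by (simp add: inverse_eq_divide)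
  finally show ?case
    using step by simp
qed (use assms in simp)

text \<open>With k the ceiling of m / 3, it suffices that the harmonic difference is at least 2 - 3
  * k / m. It is at least ln 3 - ln (3 * k / m), and ln 3 \<ge> 1 and ln x \<le> x - 1
  finish.\<close>

lemma mean_cap_three_halves_ge:
  assumes "m \<ge> 1"
  shows "1 \<le> mean_cap m (3/2)"
proof -
  define k where "k = nat \<lceil>(1 - 1 / (3/2)) * real m\<rceil>"
  have pos: "0 < (1 - 1 / (3/2)) * real m"
    using assms by simp
  then have k: "\<lceil>(1 - 1 / (3/2)) * real m\<rceil> = int k"
    unfolding k_def by (subst nat_0_le) (auto simp: zero_less_ceiling simp del: ceiling_le_zero)
  have "0 < \<lceil>(1 - 1 / (3/2)) * real m\<rceil>"
    using pos by (simp only: zero_less_ceiling)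
  then have "1 \<le> k"
    unfolding k by simp
  have "\<lceil>(1 - 1 / (3/2)) * real m\<rceil> \<le> int m"
    by (simp add: ceiling_le_iff)
  then have "k \<le> m"
    using k by simp
  have "ln (3 * real k / real m) \<le> 3 * real k / real m - 1"
    using \<open>1 \<le> k\<close> assms by (intro ln_le_minus_one) auto
  moreover have "ln (3 * real k / real m) = ln 3 - ln (real m / real k)"
    using \<open>1 \<le> k\<close> assms by (simp add: ln_div ln_mult)
  moreover have "1 \<le> ln (3::real)"
    using exp_le by (simp add: ln_ge_iff)
  moreover have "ln (real m / real k) \<le> harm (m - 1) - harm (k - 1)"
    using \<open>1 \<le> k\<close> \<open>k \<le> m\<close> by (rule ln_le_harm_diff)
  ultimately have "2 \<le> (harm (m - 1) - harm (k - 1)) + 3 * real k / real m"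
    by linarith
  then have "1 \<le> f_comp m (3/2)"
    unfolding f_comp_def k by (simp add: field_simps)
  then show ?thesis
    using assms by (simp add: f_comp_eq_mean_cap)
qed

text \<open>The intermediate value theorem on [4/3, 3/2] gives a solution; strict monotonicity makes
  it the only one among all \<alpha> > 1.\<close>

lemma ex1_f_comp:
  assumes "m \<ge> 2"
  shows "\<exists>!\<alpha>. \<alpha> > 1 \<and> f_comp m \<alpha> = 1" (is ?thesis1)
    and "4/3 \<le> alpha m" "alpha m \<le> 3/2" "(\<Sum>j=1..m. beta m (alpha m) j) = real m"
proof -
  obtain x where x: "4/3 \<le> x" "x \<le> 3/2" "mean_cap m x = 1"
    using IVT'[of "mean_cap m" "4/3" 1 "3/2"] mean_cap_four_thirds_le[of m]
      mean_cap_three_halves_ge[of m] continuous_on_mean_cap[of "{4/3..3/2}" m] assms by auto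
  have uniq: "y = x" if "y > 1" "f_comp m y = 1" for y
    using that x assms mean_cap_strict_mono[of x y m] mean_cap_strict_mono[of y x m]
    by (cases x y rule: linorder_cases) (auto simp: f_comp_eq_mean_cap)
  have fx: "x > 1 \<and> f_comp m x = 1"
    using x assms by (simp add: f_comp_eq_mean_cap)
  then show ?thesis1
    using uniq by blast
  have "alpha m = x"
    unfolding alpha_def using fx uniq by blast
  then show "4/3 \<le> alpha m" "alpha m \<le> 3/2" "(\<Sum>j=1..m. beta m (alpha m) j) = real m"
    using x assms mean_cap_eq_beta[of x m] by (auto simp: field_simps)
qed

section \<open>Job sizes and lower bounds on the load\<close>

lemma le_nth_iff_length_filter:
  fixes xs :: "'a::linorder list"
  assumes "sorted_wrt (\<ge>) xs" "k < length xs"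
  shows "x \<le> xs ! k \<longleftrightarrow> k < length (filter ((\<le>) x) xs)"
  using assms
proof (induction xs arbitrary: k)
  case (Cons a xs)
  show ?case
  proof (cases "x \<le> a")
    case True
    then show ?thesis
      using Cons by (cases k) auto
  next
    case False
    then have "\<forall>y\<in>set (a # xs). \<not> x \<le> y"
      using Cons.prems by auto
    then have "filter ((\<le>) x) (a # xs) = []" "\<not> x \<le> (a # xs) ! k"
      using Cons.prems(2) nth_mem[of k "a # xs"] by (auto simp: filter_empty_conv)
    then show ?thesis
      by simp
  qed
qed simp

lemma sorted_wrt_rev_sort: "sorted_wrt (\<ge>) (rev (sort xs))" for xs :: "'a::linorder list"
  by (simp add: sorted_wrt_rev)

text \<open>Entries that are at least x form a prefix of the non-increasing list. Positivity of x
  matches the default value 0 of \<open>p_largest\<close> beyond rank t.\<close>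

lemma le_p_largest_iff:
  assumes "1 \<le> i" "0 < x"
  shows "x \<le> p_largest p t i \<longleftrightarrow> i \<le> card {j\<in>{1..t}. x \<le> p j}"
proof -
  let ?xs = "rev (sort (map p [1..<Suc t]))"
  have "card {j\<in>{1..t}. x \<le> p j} = length (filter ((\<le>) x) (map p [1..<Suc t]))"
    by (simp add: filter_map comp_def distinct_length_filter atLeastLessThanSuc_atLeastAtMost
        Int_def conj_ac del: upt_Suc)
  also have "\<dots> = length (filter ((\<le>) x) ?xs)"
    by (simp only: size_mset[symmetric] mset_filter mset_rev mset_sort)
  finally have card: "card {j\<in>{1..t}. x \<le> p j} = length (filter ((\<le>) x) ?xs)" .
  show ?thesis
  proof (cases "i \<le> t")
    case True
    then show ?thesis
      using assms le_nth_iff_length_filter[OF sorted_wrt_rev_sort, of "i - 1" "map p [1..<Suc t]" x]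
      unfolding card p_largest_def by (auto simp del: upt_Suc)
  next
    case False
    moreover have "card {j\<in>{1..t}. x \<le> p j} \<le> t"
      using card_mono[of "{1..t}" "{j\<in>{1..t}. x \<le> p j}"] by force
    ultimately show ?thesis
      using assms by (simp add: p_largest_def)
  qed
qed

lemma p_largest_mono:
  assumes "1 \<le> i" "s \<le> t" "\<And>j. j \<in> {1..t} \<Longrightarrow> 0 < p j"
  shows "p_largest p s i \<le> p_largest p t i"
proof (cases "0 < p_largest p s i")
  case True
  then have "i \<le> card {j\<in>{1..s}. p_largest p s i \<le> p j}"
    using assms le_p_largest_iff by blast
  also have "\<dots> \<le> card {j\<in>{1..t}. p_largest p s i \<le> p j}"
    using assms by (intro card_mono) auto
  finally show ?thesis
    using assms True le_p_largest_iff by blast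
next
  case False
  have "0 \<le> p_largest p t i"
  proof (cases "i \<le> t")
    case True
    then have "p_largest p t i \<in> set (rev (sort (map p [1..<Suc t])))"
      using assms by (simp add: p_largest_def del: upt_Suc set_rev set_sort)
    then show ?thesis
      using assms(3) by (auto simp: less_imp_le simp del: upt_Suc)
  qed (simp add: p_largest_def)
  with False show ?thesis
    by simp
qed

text \<open>As rank k + 1 does not exceed c, every job above c is among the first k ranks. This
  replaces the sum of the \<open>p_hat\<close> values by a sum over large jobs.\<close>

lemma sum_top_eq_sum_gt:
  assumes "p_largest p t (Suc k) \<le> c" "0 \<le> c"
  shows "(\<Sum>i=1..k. if p_largest p t i > c then p_largest p t i else 0)
    = sum p {j\<in>{1..t}. p j > c}"
proof -
  define xs where "xs = rev (sort (map p [1..<Suc t]))"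
  define F where "F y = (if y > c then y else 0)" for y
  have len: "length xs = t"
    by (simp add: xs_def del: upt_Suc)
  have tail: "F (xs ! i) = 0" if "k \<le> i" "i < t" for i
  proof -
    have "xs ! i \<le> xs ! k"
      using that len sorted_wrt_nth_less[OF sorted_wrt_rev_sort[of "map p [1..<Suc t]"], of k i]
      by (cases "i = k") (auto simp: xs_def simp del: upt_Suc)
    also have "\<dots> = p_largest p t (Suc k)"
      using that by (simp add: p_largest_def xs_def del: upt_Suc)
    finally show ?thesis
      using assms by (simp add: F_def)
  qed
  have "(\<Sum>i=1..k. if p_largest p t i > c then p_largest p t i else 0)
      = (\<Sum>i<k. if i < t then F (xs ! i) else 0)"
    using assms(2)
    by (intro sum.reindex_bij_witness[where i = Suc and j = "\<lambda>i. i - 1"])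
       (auto simp: p_largest_def F_def xs_def simp del: upt_Suc)
  also have "\<dots> = (\<Sum>i<t. F (xs ! i))"
    by (intro sum.mono_neutral_cong) (use tail in \<open>auto simp: not_less\<close>)
  also have "\<dots> = sum_list (map F xs)"
    by (simp add: sum_list_sum_nth len atLeast0LessThan)
  also have "\<dots> = sum_list (map F (map p [1..<Suc t]))"
    unfolding xs_def sum_mset_sum_list[symmetric] mset_map mset_rev mset_sort ..
  also have "\<dots> = (\<Sum>j\<in>{1..t}. F (p j))"
    by (simp add: comp_def sum_list_distinct_conv_sum_set atLeastLessThanSuc_atLeastAtMost del: upt_Suc)
  also have "\<dots> = sum p {j\<in>{1..t}. p j > c}"
    unfolding F_def by (rule sum.inter_filter[symmetric]) simp
  finally show ?thesis .
qed

text \<open>The ratio stays abstract here: it enters only through its two bounds and the sum of the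
  \<open>beta\<close> values.\<close>

locale migration_setting =
  fixes m n :: nat and p :: "nat \<Rightarrow> real" and \<alpha> :: real
  assumes m_ge2: "m \<ge> 2"
    and p_pos: "i \<in> {1..n} \<Longrightarrow> 0 < p i"
    and alpha_ge: "4/3 \<le> \<alpha>"
    and alpha_le: "\<alpha> \<le> 3/2"
    and sum_beta: "(\<Sum>j=1..m. beta m \<alpha> j) = real m"
begin

abbreviation "L \<equiv> L_bound m p"
abbreviation "Ls \<equiv> L_star m \<alpha> p"
abbreviation "b \<equiv> beta m \<alpha>"
abbreviation "small \<equiv> small_at m \<alpha> p"

lemma sum_p_nonneg: "A \<subseteq> {1..n} \<Longrightarrow> 0 \<le> sum p A"
  using p_pos by (intro sum_nonneg) force

lemma sum_p_mono: "A \<subseteq> B \<Longrightarrow> B \<subseteq> {1..n} \<Longrightarrow> sum p A \<le> sum p B"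
  using finite_subset[of B "{1..n}"] by (intro sum_mono2) (auto intro!: less_imp_le p_pos)

lemma p_plus_le_L: "p_plus p t \<le> real m * L t"
proof -
  have "p_plus p t / real m \<le> L t"
    by (simp add: L_bound_def)
  then show ?thesis
    using m_ge2 by (simp add: field_simps)
qed

lemma L_mono:
  assumes "s \<le> t" "t \<le> n"
  shows "L s \<le> L t"
proof -
  have "p_plus p s \<le> p_plus p t"
    using assms unfolding p_plus_def by (intro sum_p_mono) auto
  moreover have "p_largest p s (2 * m + 1) \<le> p_largest p t (2 * m + 1)"
    using assms p_pos by (intro p_largest_mono) auto
  ultimately show ?thesis
    unfolding L_bound_def by (intro max.mono divide_right_mono mult_left_mono) auto
qed

lemma L_nonneg:
  assumes "t \<le> n"
  shows "0 \<le> L t"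
  using assms sum_p_nonneg[of "{1..t}"] by (simp add: L_bound_def p_plus_def le_max_iff_disj)

lemma L_pos:
  assumes "1 \<le> t" "t \<le> n"
  shows "0 < L t"
proof -
  have "0 < p_plus p t"
    using assms p_pos unfolding p_plus_def by (intro sum_pos) auto
  then show ?thesis
    using m_ge2 by (simp add: L_bound_def less_max_iff_disj)
qed

text \<open>As \<alpha> - 1 \<ge> 1/3, the term 3 * \<open>p_largest p t (2 * m + 1)\<close> in
  \<open>L_bound\<close> keeps this job size below the threshold for large jobs.\<close>

lemma p_largest_le: "t \<le> n \<Longrightarrow> p_largest p t (Suc (2 * m)) \<le> (\<alpha> - 1) * L t"
proof -
  assume "t \<le> n"
  have "3 * p_largest p t (Suc (2 * m)) \<le> L t"
    by (simp add: L_bound_def)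
  also have "\<dots> \<le> 3 * ((\<alpha> - 1) * L t)"
    using alpha_ge L_nonneg[OF \<open>t \<le> n\<close>] mult_right_mono[of 1 "3 * (\<alpha> - 1)" "L t"] by (simp add: mult.assoc[symmetric])
  finally show ?thesis
    by simp
qed

text \<open>All large jobs are among the 2 * m largest, so subtracting the \<open>p_hat\<close>
  values leaves exactly the small jobs.\<close>

lemma L_star_eq:
  assumes "t \<le> n"
  shows "real m * Ls t = sum p {i\<in>{1..t}. small t i}"
proof -
  have "(\<Sum>i=1..2*m. p_hat m \<alpha> p t i) = sum p {i\<in>{1..t}. \<not> small t i}"
    using sum_top_eq_sum_gt[OF p_largest_le[OF assms]] alpha_ge L_nonneg[OF assms]
    by (simp add: p_hat_def small_at_def not_le)
  moreover have "p_plus p t = sum p {i\<in>{1..t}. small t i} + sum p {i\<in>{1..t}. \<not> small t i}"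
    unfolding p_plus_def by (subst sum.union_disjoint[symmetric]) (auto intro: sum.cong)
  ultimately show ?thesis
    using m_ge2 by (simp add: L_star_def)
qed

lemma card_large_le:
  assumes "t \<le> n"
  shows "card {i\<in>{1..t}. \<not> small t i} \<le> 2 * m"
proof (rule ccontr)
  let ?B = "{i\<in>{1..t}. \<not> small t i}"
  assume *: "\<not> card ?B \<le> 2 * m"
  then have "?B \<noteq> {}"
    by (metis card.empty zero_le)
  \<comment> \<open>The smallest large job: more than 2 * m large jobs would put rank 2 * m + 1 at
    or above x, hence above the threshold.\<close>
  define x where "x = Min (p ` ?B)"
  have "x \<in> p ` ?B"
    unfolding x_def using \<open>?B \<noteq> {}\<close> by (intro Min_in) auto
  then obtain i where i: "i \<in> ?B" "x = p i"
    by auto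
  have "x > (\<alpha> - 1) * L t"
    using i by (simp add: small_at_def)
  have "0 < x"
    using i p_pos assms by auto
  have "?B \<subseteq> {j\<in>{1..t}. x \<le> p j}"
    by (auto simp: x_def)
  then have "card ?B \<le> card {j\<in>{1..t}. x \<le> p j}"
    by (intro card_mono) auto
  then have "x \<le> p_largest p t (Suc (2 * m))"
    using * \<open>0 < x\<close> by (subst le_p_largest_iff) auto
  then show False
    using p_largest_le[OF assms] \<open>x > (\<alpha> - 1) * L t\<close> by simp
qed

text \<open>\<open>L\<close> never decreases, so neither does the threshold.\<close>

lemma small_mono:
  assumes "small s i" "s \<le> t" "t \<le> n"
  shows "small t i"
proof -
  have "(\<alpha> - 1) * L s \<le> (\<alpha> - 1) * L t"
    using L_mono[OF assms(2,3)] alpha_ge by (intro mult_left_mono) auto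
  then show ?thesis
    using assms(1) by (simp add: small_at_def)
qed

lemma L_star_mono:
  assumes "s \<le> t" "t \<le> n"
  shows "Ls s \<le> Ls t"
proof -
  have "sum p {i\<in>{1..s}. small s i} \<le> sum p {i\<in>{1..t}. small t i}"
    using assms small_mono by (intro sum_p_mono) auto
  then have "real m * Ls s \<le> real m * Ls t"
    using assms by (simp add: L_star_eq)
  then show ?thesis
    using m_ge2 by simp
qed

lemma L_star_nonneg:
  assumes "t \<le> n"
  shows "0 \<le> Ls t"
proof -
  have "0 \<le> real m * Ls t"
    unfolding L_star_eq[OF assms] using assms by (intro sum_p_nonneg) auto
  then show ?thesis
    using m_ge2 by (simp add: zero_le_mult_iff)
qed

lemma L_star_le_L:
  assumes "t \<le> n"
  shows "Ls t \<le> L t"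
proof -
  have "real m * Ls t \<le> p_plus p t"
    unfolding L_star_eq[OF assms] p_plus_def using assms by (intro sum_p_mono) auto
  also have "\<dots> \<le> real m * L t"
    by (rule p_plus_le_L)
  finally show ?thesis
    using m_ge2 by simp
qed

lemma beta_pos: "j \<in> {1..m} \<Longrightarrow> 0 < b j"
  and beta_le: "j \<in> {1..m} \<Longrightarrow> b j \<le> \<alpha>"
  using alpha_ge by (auto simp: beta_eq_min)

text \<open>The cap on \<open>beta\<close> without division, which includes j = m.\<close>

lemma beta_mult_gap_le:
  assumes "j \<in> {1..m}"
  shows "b j * (real m - real j) \<le> (\<alpha> - 1) * real m"
proof (cases "j = m")
  case False
  then have "b j \<le> (\<alpha> - 1) * (real m / real (m - j))"
    using assms alpha_ge by (simp add: beta_eq_min)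
  then show ?thesis
    using assms False by (simp add: field_simps of_nat_diff)
qed (use alpha_ge in simp)

end

section \<open>Runs of the algorithm and bounds on the optimum\<close>

text \<open>Different machines hold disjoint sets of jobs. The weight q and the filter P are free so
  that loads, small loads and job counts are all covered.\<close>

lemma sum_over_machines:
  assumes "finite (dom S)" "finite J"
  shows "(\<Sum>j\<in>J. sum q {i. S i = Some j \<and> P i}) = sum q {i. \<exists>j\<in>J. S i = Some j \<and> P i}"
proof -
  have fin: "finite {i. S i = Some j \<and> P i}" for j
    using assms(1) by (rule finite_subset[rotated]) auto
  have "{i. \<exists>j\<in>J. S i = Some j \<and> P i} = (\<Union>j\<in>J. {i. S i = Some j \<and> P i})"
    by auto
  then show ?thesis
    using assms(2) fin by (simp only:) (subst sum.UNION_disjoint, auto)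
qed

lemma ex_least_loaded:
  assumes "1 \<le> m"
  shows "\<exists>j. least_loaded m p S j"
proof -
  obtain j where "is_arg_min (load p S) (\<lambda>j. j \<in> {1..m}) j"
    using ex_is_arg_min_if_finite[of "{1..m}" "load p S"] assms by auto
  then show ?thesis
    by (auto simp: is_arg_min_linorder least_loaded_def)
qed

section \<open>Schedules reached by the phases\<close>

lemma arrival_dom_ran:
  assumes "arrival m \<alpha> p t S"
  shows "dom S = {1..t}" "ran S \<subseteq> {1..m}"
proof -
  have "dom S = {1..t} \<and> ran S \<subseteq> {1..m}"
    using assms
  proof induction
    case (arrival_small t S j)
    then have "Suc t \<notin> dom S"
      by simp
    then have "S (Suc t) = None"
      by (simp only: domIff not_not)
    then have "ran (S(Suc t \<mapsto> j)) = insert j (ran S)"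
      by (rule ran_map_upd)
    moreover have "dom (S(Suc t \<mapsto> j)) = insert (Suc t) (dom S)"
      by (simp only: dom_fun_upd option.simps if_False)
    moreover have "insert (Suc t) {1..t} = {1..Suc t}"
      by auto
    moreover have "j \<in> {1..m}"
      using arrival_small by (simp add: admissible_def)
    ultimately show ?case
      using arrival_small.IH by (metis insert_subset)
  next
    case (arrival_large t S j)
    then have "Suc t \<notin> dom S"
      by simp
    then have "S (Suc t) = None"
      by (simp only: domIff not_not)
    then have "ran (S(Suc t \<mapsto> j)) = insert j (ran S)"
      by (rule ran_map_upd)
    moreover have "dom (S(Suc t \<mapsto> j)) = insert (Suc t) (dom S)"
      by (simp only: dom_fun_upd option.simps if_False)
    moreover have "insert (Suc t) {1..t} = {1..Suc t}"
      by auto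
    moreover have "j \<in> {1..m}"
      using arrival_large by (simp add: least_loaded_def)
    ultimately show ?case
      using arrival_large.IH by (metis insert_subset)
  qed simp
  then show "dom S = {1..t}" "ran S \<subseteq> {1..m}"
    by auto
qed

lemma removal_eq:
  assumes "removal m \<alpha> p n S\<^sub>0 S R"
  shows "R \<subseteq> dom S\<^sub>0" "S = (\<lambda>i. if i \<in> R then None else S\<^sub>0 i)"
proof -
  have "R \<subseteq> dom S\<^sub>0 \<and> S = (\<lambda>i. if i \<in> R then None else S\<^sub>0 i)"
    using assms by induction (auto simp: fun_eq_iff split: if_splits)
  then show "R \<subseteq> dom S\<^sub>0" "S = (\<lambda>i. if i \<in> R then None else S\<^sub>0 i)"
    by auto
qed

text \<open>A removed job was largest on its machine at that moment, and afterwards the machine only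
  loses jobs.\<close>

lemma removed_ge_remaining:
  assumes "removal m \<alpha> p n S\<^sub>0 S R" "i \<in> R" "S\<^sub>0 i = Some j" "S k = Some j"
  shows "p k \<le> p i"
  using assms
proof (induction arbitrary: i j k)
  case (removal_step S R j' i')
  have "S i' = S\<^sub>0 i'"
    using removal_eq[OF removal_step.hyps(1)] removal_step.hyps(3)
    by (metis option.distinct(1))
  with removal_step show ?case
    by (auto split: if_splits)
qed simp

lemma ex_greedy:
  assumes "1 \<le> m"
  shows "\<exists>S'. greedy m p Bs S S'"
proof (induction Bs arbitrary: S)
  case (Cons B Bs)
  obtain j where "least_loaded m p S j"
    using ex_least_loaded assms by blast
  with Cons[of "assign_set B j S"] show ?case
    by (blast intro: greedy_Cons)
qed (blast intro: greedy_Nil)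

lemma greedy_dom_ran:
  assumes "greedy m p Bs S S'"
  shows "dom S' = dom S \<union> \<Union>(set Bs)" "ran S' \<subseteq> ran S \<union> {1..m}"
proof -
  have "dom S' = dom S \<union> \<Union>(set Bs) \<and> ran S' \<subseteq> ran S \<union> {1..m}"
    using assms
  proof induction
    case (greedy_Cons S j Bs B S')
    have "ran (assign_set B j S) \<subseteq> ran S \<union> {1..m}"
      using greedy_Cons.hyps(1) by (auto simp: assign_set_def ran_def least_loaded_def)
    moreover have "dom (assign_set B j S) = dom S \<union> B"
      by (auto simp: assign_set_def dom_def)
    ultimately show ?case
      using greedy_Cons.IH by auto
  qed simp
  then show "dom S' = dom S \<union> \<Union>(set Bs)" "ran S' \<subseteq> ran S \<union> {1..m}"
    by auto
qed

text \<open>Sorting by negated sizes supplies the non-increasing orders, and the greedy steps can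
  always continue.\<close>

lemma ex_reassignment:
  assumes "1 \<le> m" "finite R"
  shows "\<exists>S'. reassignment m \<alpha> p n R S S'"
proof -
  define R' where "R' = {i \<in> R. p i > (\<alpha> - 1) * L_bound m p n}"
  define rs where "rs = sort_key (\<lambda>i. - p i) (sorted_list_of_set R')"
  define Ps where "Ps = sort_key (\<lambda>A. - sum p A) (map (pair_set m p rs) [1..<Suc m])"
  define qs where "qs = sorted_list_of_set (R - (\<Union>i\<in>{1..m}. pair_set m p rs i))"
  have "finite R'"
    using assms by (simp add: R'_def)
  then have "distinct rs" "set rs = R'"
    by (simp_all add: rs_def)
  moreover have "sorted_wrt (\<lambda>x y. p x \<ge> p y) rs"
    using sorted_sort_key[of "\<lambda>i. - p i" "sorted_list_of_set R'"]
    by (simp add: rs_def sorted_map)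
  moreover have "mset Ps = mset (map (pair_set m p rs) [1..<Suc m])"
    by (simp add: Ps_def del: upt_Suc)
  moreover have "sorted_wrt (\<lambda>A B. sum p A \<ge> sum p B) Ps"
    using sorted_sort_key[of "\<lambda>A. - sum p A" "map (pair_set m p rs) [1..<Suc m]"]
    by (simp add: Ps_def sorted_map del: upt_Suc)
  moreover have "distinct qs" "set qs = R - (\<Union>i\<in>{1..m}. pair_set m p rs i)"
    using assms by (simp_all add: qs_def)
  moreover obtain S\<^sub>P where "greedy m p Ps S S\<^sub>P"
    using ex_greedy assms by blast
  moreover obtain S' where "greedy m p (map (\<lambda>i. {i}) qs) S\<^sub>P S'"
    using ex_greedy assms by blast
  ultimately show ?thesis
    unfolding reassignment_def R'_def by blast
qed

section \<open>Optimal schedules\<close>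

lemma finite_complete_schedules: "finite (complete_schedules m n)"
  unfolding complete_schedules_def
  by (rule finite_subset[OF _ finite_set_of_finite_maps[of "{1..n}" "{1..m}"]]) auto

lemma complete_schedules_nonempty:
  assumes "1 \<le> m"
  shows "complete_schedules m n \<noteq> {}"
proof -
  have "(\<lambda>i. if i \<in> {1..n} then Some 1 else None) \<in> complete_schedules m n"
    using assms by (auto simp: complete_schedules_def ran_def dom_def split: if_splits)
  then show ?thesis
    by blast
qed

lemma OPT_attained:
  assumes "1 \<le> m"
  obtains S where "dom S = {1..n}" "\<And>i. i \<in> {1..n} \<Longrightarrow> \<exists>j\<in>{1..m}. S i = Some j"
    "\<And>j. j \<in> {1..m} \<Longrightarrow> load p S j \<le> OPT m p n"
proof -
  have "OPT m p n \<in> makespan m p ` complete_schedules m n"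
    unfolding OPT_def using assms finite_complete_schedules complete_schedules_nonempty
    by (intro Min_in) auto
  then obtain S where S: "S \<in> complete_schedules m n" "OPT m p n = makespan m p S"
    by blast
  have dom: "dom S = {1..n}"
    using S(1) by (simp add: complete_schedules_def)
  have mach: "\<exists>j\<in>{1..m}. S i = Some j" if "i \<in> {1..n}" for i
  proof -
    have "i \<in> dom S"
      using dom that by simp
    then obtain j where "S i = Some j"
      by (rule domD[THEN exE])
    moreover have "ran S \<subseteq> {1..m}"
      using S(1) by (simp add: complete_schedules_def)
    ultimately show ?thesis
      by (meson ranI subsetD)
  qed
  have "load p S j \<le> OPT m p n" if "j \<in> {1..m}" for j
    using that unfolding S(2) makespan_def by (intro Max_ge) auto
  with dom mach show thesis
    by (rule that)
qed

section \<open>Averaging, existence of runs and optimality of the removal rule\<close>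

context migration_setting
begin

lemma load_eq: "load p S j = sum p {i. S i = Some j \<and> True}"
  by (simp add: load_def)

lemma sum_load_le:
  assumes "dom S \<subseteq> {1..t}" "t \<le> n"
  shows "(\<Sum>j=1..m. load p S j) \<le> p_plus p t"
proof -
  have "finite (dom S)"
    using assms(1) finite_subset by blast
  then have "(\<Sum>j=1..m. load p S j) = sum p {i. \<exists>j\<in>{1..m}. S i = Some j \<and> True}"
    by (simp only: load_eq sum_over_machines finite_atLeastAtMost)
  also have "\<dots> \<le> p_plus p t"
    unfolding p_plus_def using assms by (intro sum_p_mono) auto
  finally show ?thesis .
qed

lemma least_loaded_le:
  assumes "least_loaded m p S j" "dom S \<subseteq> {1..t}" "t \<le> n"
  shows "load p S j \<le> L t"
proof -
  have "real m * load p S j = (\<Sum>k=1..m. load p S j)"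
    by simp
  also have "\<dots> \<le> (\<Sum>k=1..m. load p S k)"
    using assms(1) by (intro sum_mono) (auto simp: least_loaded_def)
  also have "\<dots> \<le> real m * L t"
    using sum_load_le[OF assms(2,3)] p_plus_le_L[of t] by linarith
  finally show ?thesis
    using m_ge2 by simp
qed

text \<open>If every machine violated its bound, the small loads would add up to more than m *
  \<open>Ls (Suc t)\<close>, since the \<open>beta\<close> values sum to m; but this is the total
  size of all small jobs.\<close>

lemma ex_admissible:
  assumes "t < n" "dom S = {1..t}"
  shows "\<exists>j. admissible m \<alpha> p S (Suc t) j"
proof (rule ccontr)
  have dom: "i \<in> {1..t}" if "S i = Some j" for i j
    using domI[of S i j] that assms(2) by simp
  assume "\<nexists>j. admissible m \<alpha> p S (Suc t) j"
  then have "b j * Ls (Suc t) < small_load m \<alpha> p S j (Suc t)" if "j \<in> {1..m}" for j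
    using that by (auto simp: admissible_def)
  then have "(\<Sum>j=1..m. b j * Ls (Suc t)) < (\<Sum>j=1..m. small_load m \<alpha> p S j (Suc t))"
    using m_ge2 by (intro sum_strict_mono) auto
  also have "(\<Sum>j=1..m. b j * Ls (Suc t)) = real m * Ls (Suc t)"
    using sum_beta by (simp add: sum_distrib_right[symmetric])
  also have "(\<Sum>j=1..m. small_load m \<alpha> p S j (Suc t))
      = sum p {i. \<exists>j\<in>{1..m}. S i = Some j \<and> small (Suc t) i}"
    unfolding small_load_def using assms by (simp add: sum_over_machines)
  also have "\<dots> \<le> sum p {i\<in>{1..Suc t}. small (Suc t) i}"
  proof (rule sum_p_mono)
    show "{i. \<exists>j\<in>{1..m}. S i = Some j \<and> small (Suc t) i} \<subseteq> {i \<in> {1..Suc t}. small (Suc t) i}"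
      using dom by force
  qed (use assms(1) in auto)
  finally show False
    using assms by (simp add: L_star_eq)
qed

lemma ex_arrival: "t \<le> n \<Longrightarrow> \<exists>S. arrival m \<alpha> p t S"
proof (induction t)
  case (Suc t)
  then obtain S where S: "arrival m \<alpha> p t S"
    by auto
  show ?case
  proof (cases "small (Suc t) (Suc t)")
    case True
    then obtain j where "admissible m \<alpha> p S (Suc t) j"
      using ex_admissible[of t S] arrival_dom_ran[OF S] Suc.prems by auto
    then show ?thesis
      using S True by (blast intro: arrival_small)
  next
    case False
    then show ?thesis
      using S ex_least_loaded[of m p S] m_ge2 by (auto intro: arrival_large)
  qed
qed (blast intro: arrival_init)

text \<open>An exceeding machine has positive load, hence a job to remove, and each removal lowers
  the number of assigned jobs.\<close>

lemma ex_removal: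
  assumes "removal m \<alpha> p n S\<^sub>0 S R" "finite (dom S)"
  shows "\<exists>S' R'. removal m \<alpha> p n S\<^sub>0 S' R' \<and> (\<forall>j. \<not> exceeds m \<alpha> p n S' j)"
  using assms
proof (induction "card (dom S)" arbitrary: S R rule: less_induct)
  case less
  show ?case
  proof (cases "\<exists>j. exceeds m \<alpha> p n S j")
    case True
    then obtain j where j: "exceeds m \<alpha> p n S j"
      by blast
    let ?A = "{i. S i = Some j}"
    have "finite ?A"
      using less.prems(2) by (rule finite_subset[rotated]) auto
    have "0 \<le> (\<alpha> - 1) * L n"
      using alpha_ge L_nonneg[of n] by simp
    then have "load p S j > 0"
      using j by (simp add: exceeds_def)
    then have "?A \<noteq> {}"
      unfolding load_def by (metis less_irrefl sum.empty)
    then have "Max (p ` ?A) \<in> p ` ?A"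
      using \<open>finite ?A\<close> by (intro Max_in) auto
    then obtain i where i: "S i = Some j" "p i = Max (p ` ?A)"
      by auto
    then have "\<forall>k. S k = Some j \<longrightarrow> p k \<le> p i"
      using \<open>finite ?A\<close> by simp
    then have "removal m \<alpha> p n S\<^sub>0 (S(i := None)) (insert i R)"
      using less.prems(1) j i by (blast intro: removal_step)
    moreover have "card (dom (S(i := None))) < card (dom S)"
      using less.prems(2) i by (auto intro!: card_Diff1_less)
    ultimately show ?thesis
      using less.hyps[of "S(i := None)"] less.prems(2) by auto
  qed (use less.prems in blast)
qed

lemma ex_ALG: "\<exists>S R. ALG m \<alpha> p n S R"
proof -
  obtain S\<^sub>0 where S0: "arrival m \<alpha> p n S\<^sub>0"
    using ex_arrival by blast
  then have "finite (dom S\<^sub>0)"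
    by (simp add: arrival_dom_ran)
  then obtain S\<^sub>1 R where S1: "removal m \<alpha> p n S\<^sub>0 S\<^sub>1 R" "\<forall>j. \<not> exceeds m \<alpha> p n S\<^sub>1 j"
    using ex_removal[OF removal_init] by blast
  then have "finite R"
    using removal_eq(1)[OF S1(1)] \<open>finite (dom S\<^sub>0)\<close> finite_subset by blast
  then show ?thesis
    using S0 S1 ex_reassignment[of m R] m_ge2 unfolding ALG_def by fastforce
qed

text \<open>Exchange argument: once \<open>card D\<close> jobs have left machine j, they weigh at
  least as much as D. The load is then within the threshold and nothing more is removed from
  j.\<close>

lemma removal_card_le:
  assumes "removal m \<alpha> p n S\<^sub>0 S R" "dom S\<^sub>0 \<subseteq> {1..n}" "D \<subseteq> {i. S\<^sub>0 i = Some j}"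
    and "sum p ({i. S\<^sub>0 i = Some j} - D) \<le> max (b j * Ls n) ((\<alpha> - 1) * L n)"
  shows "card (R \<inter> {i. S\<^sub>0 i = Some j}) \<le> card D"
  using assms
proof induction
  case (removal_step S R j' i)
  let ?A = "{i. S\<^sub>0 i = Some j}"
  let ?B = "R \<inter> ?A"
  have IH: "card ?B \<le> card D"
    using removal_step by simp
  have A: "?A \<subseteq> {1..n}"
    using removal_step.prems(1) by auto
  have fin: "finite ?A" "finite ?B" "finite D"
    using A removal_step.prems(2) by (auto intro: finite_subset)
  have S: "S = (\<lambda>i. if i \<in> R then None else S\<^sub>0 i)"
    by (rule removal_eq(2)[OF removal_step.hyps(1)])
  have i: "i \<notin> R" "S\<^sub>0 i = Some j'"
    using removal_step.hyps(3) S by (auto split: if_splits)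
  show ?case
  proof (cases "j' = j")
    case False
    then have "insert i R \<inter> ?A = ?B"
      using i by auto
    then show ?thesis
      using IH by simp
  next
    case True
    have "card ?B < card D"
    proof (rule ccontr)
      assume "\<not> card ?B < card D"
      then have card: "card (D - ?B) \<le> card (?B - D)"
        using fin IH by (simp add: card_Diff_subset_Int Int_commute)
      have "sum p (D - ?B) \<le> sum p (?B - D)"
      proof (cases "D - ?B = {}")
        case True
        have "0 \<le> sum p (?B - D)"
          using A by (intro sum_p_nonneg) auto
        then show ?thesis
          by (simp only: True sum.empty)
      next
        case False
        have le: "p k \<le> p r" if "k \<in> D - ?B" "r \<in> ?B - D" for k r
          using removed_ge_remaining[OF removal_step.hyps(1), of r j k] that removal_step.prems(2) S
          by auto
        \<comment> \<open>Jobs of \<open>D - ?B\<close> are still on the machine, so x bounds them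
          from above and the removed jobs of \<open>?B - D\<close> from below; the latter are at
          least as numerous.\<close>
        define x where "x = Max (p ` (D - ?B))"
        have "x \<in> p ` (D - ?B)"
          unfolding x_def using False fin by (intro Max_in) auto
        then obtain k where k: "k \<in> D - ?B" "x = p k"
          by auto
        have "k \<in> {1..n}"
          using k(1) removal_step.prems(2) A by auto
        then have "0 \<le> x"
          using k(2) p_pos by (simp add: less_imp_le)
        have "sum p (D - ?B) \<le> real (card (D - ?B)) * x"
          using fin by (intro sum_bounded_above) (auto simp: x_def)
        also have "\<dots> \<le> real (card (?B - D)) * x"
          using card \<open>0 \<le> x\<close> by (intro mult_right_mono) auto
        also have "\<dots> \<le> sum p (?B - D)"
          using k le by (intro sum_bounded_below) auto
        finally show ?thesis .
      qed
      moreover have "sum p D = sum p (D \<inter> ?B) + sum p (D - ?B)" "sum p ?B = sum p (D \<inter> ?B) + sum p (?B - D)"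
        using fin by (simp_all add: sum.Int_Diff[of D p ?B] sum.Int_Diff[of ?B p D] Int_commute)
      moreover have "sum p (?A - D) = sum p ?A - sum p D" "sum p (?A - ?B) = sum p ?A - sum p ?B"
        using fin removal_step.prems(2) by (auto intro!: sum_diff)
      ultimately have "sum p (?A - ?B) \<le> sum p (?A - D)"
        by linarith
      moreover have "load p S j = sum p (?A - ?B)"
        unfolding load_def S by (intro sum.cong) (auto split: if_splits)
      ultimately show False
        using removal_step.hyps(2) removal_step.prems(3) unfolding exceeds_def True by linarith
    qed
    moreover have "insert i R \<inter> ?A = insert i ?B"
      using i True by auto
    ultimately show ?thesis
      using fin i by (simp add: card_insert_if)
  qed
qed simp

section \<open>Lower bounds on the optimum\<close>

lemma load_ge_sum:
  assumes "dom S \<subseteq> {1..n}" "A \<subseteq> {i. S i = Some j}"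
  shows "sum p A \<le> load p S j"
  unfolding load_def using assms by (intro sum_p_mono) auto

lemma OPT_nonneg: "0 \<le> OPT m p n"
proof -
  obtain S where S: "dom S = {1..n}" "\<And>j. j \<in> {1..m} \<Longrightarrow> load p S j \<le> OPT m p n"
    by (rule OPT_attained[of m n p]) (use m_ge2 in auto)
  have "0 \<le> load p S 1"
    using load_ge_sum[of S "{}" 1] S by simp
  then show ?thesis
    using S(2)[of 1] m_ge2 by simp
qed

lemma p_le_OPT:
  assumes "i \<in> {1..n}"
  shows "p i \<le> OPT m p n"
proof -
  obtain S where S: "dom S = {1..n}" "\<And>i. i \<in> {1..n} \<Longrightarrow> \<exists>j\<in>{1..m}. S i = Some j"
      "\<And>j. j \<in> {1..m} \<Longrightarrow> load p S j \<le> OPT m p n"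
    by (rule OPT_attained[of m n p]) (use m_ge2 in auto)
  then obtain j where "S i = Some j" "j \<in> {1..m}"
    using assms by blast
  then show ?thesis
    using load_ge_sum[of S "{i}" j] S(1,3) by fastforce
qed

text \<open>
  Give every job of \<open>B\<close> weight 2 and every job of \<open>C\<close> weight 1. Some machine of an optimal
  schedule then carries weight at least 3.
\<close>

lemma pigeonhole_le_OPT:
  assumes "B \<subseteq> {1..n}" "C \<subseteq> {1..n}" "B \<inter> C = {}" "2 * m < 2 * card B + card C"
    and "\<And>i. i \<in> B \<Longrightarrow> y \<le> p i" "\<And>i. i \<in> C \<Longrightarrow> x \<le> p i" "0 \<le> x" "x \<le> y"
  shows "min (3 * x) (x + y) \<le> OPT m p n"
proof -
  obtain S where S: "dom S = {1..n}" "\<And>i. i \<in> {1..n} \<Longrightarrow> \<exists>j\<in>{1..m}. S i = Some j"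
      "\<And>j. j \<in> {1..m} \<Longrightarrow> load p S j \<le> OPT m p n"
    by (rule OPT_attained[of m n p]) (use m_ge2 in auto)
  let ?on = "\<lambda>A j. {i. S i = Some j \<and> i \<in> A}"
  have card: "(\<Sum>j=1..m. card (?on A j)) = card A" if "A \<subseteq> {1..n}" for A
  proof -
    have "{i. \<exists>j\<in>{1..m}. S i = Some j \<and> i \<in> A} = A"
      using S(2) that by auto
    then show ?thesis
      using sum_over_machines[of S "{1..m}" "\<lambda>_. 1::nat" "\<lambda>i. i \<in> A"] S(1) by simp
  qed
  have "\<exists>j\<in>{1..m}. 2 < 2 * card (?on B j) + card (?on C j)"
  proof (rule ccontr)
    assume "\<not> ?thesis"
    then have "(\<Sum>j=1..m. 2 * card (?on B j) + card (?on C j)) \<le> (\<Sum>j=1..m. 2)"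
      by (intro sum_mono) (meson not_less)
    then show False
      using assms(4) card[OF assms(1)] card[OF assms(2)]
      by (simp add: sum.distrib sum_distrib_left[symmetric])
  qed
  then obtain j where j: "j \<in> {1..m}" "2 < 2 * card (?on B j) + card (?on C j)"
    by blast
  have fin: "finite (?on B j)" "finite (?on C j)"
    by (rule finite_subset[where B = "{1..n}"]; use assms(1,2) in auto)+
  define u v where "u = card (?on B j)" and "v = card (?on C j)"
  have "min (3 * x) (x + y) \<le> real u * y + real v * x"
  proof -
    \<comment> \<open>Weight at least 3 means three jobs of C, or one of each kind, or two jobs of
      B, which is enough because y \<ge> x.\<close>
    consider "u = 0" "3 \<le> v" | "u = 1" "1 \<le> v" | "2 \<le> u"
      using j(2) unfolding u_def v_def by linarith
    then show ?thesis
    proof cases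
      case 1
      then show ?thesis
        using mult_right_mono[of 3 "real v" x] assms(7) by simp
    next
      case 2
      then show ?thesis
        using mult_right_mono[of 1 "real v" x] assms(7) by simp
    next
      case 3
      then have "2 * y \<le> real u * y" "0 \<le> real v * x"
        using assms(7,8) by (auto intro!: mult_right_mono)
      then show ?thesis
        using assms(8) by simp
    qed
  qed
  also have "\<dots> \<le> sum p (?on B j) + sum p (?on C j)"
    unfolding u_def v_def using assms(5,6) by (intro add_mono sum_bounded_below) auto
  also have "\<dots> = sum p (?on B j \<union> ?on C j)"
    using fin assms(3) by (intro sum.union_disjoint[symmetric]) auto
  also have "\<dots> \<le> load p S j"
    using S(1) by (intro load_ge_sum) auto
  also have "\<dots> \<le> OPT m p n"
    using S(3) j(1) by blast
  finally show ?thesis .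
qed

text \<open>The optimum is at least the average load, and among any 2 * m + 1 jobs some three share
  a machine.\<close>

lemma L_le_OPT: "L n \<le> OPT m p n"
proof -
  obtain S where S: "dom S = {1..n}" "\<And>i. i \<in> {1..n} \<Longrightarrow> \<exists>j\<in>{1..m}. S i = Some j"
      "\<And>j. j \<in> {1..m} \<Longrightarrow> load p S j \<le> OPT m p n"
    by (rule OPT_attained[of m n p]) (use m_ge2 in auto)
  have "{i. \<exists>j\<in>{1..m}. S i = Some j \<and> True} = {1..n}"
    using S(1,2) by auto
  then have "p_plus p n = (\<Sum>j=1..m. load p S j)"
    unfolding p_plus_def load_eq using sum_over_machines[of S "{1..m}" p "\<lambda>_. True"] S(1) by simp
  also have "\<dots> \<le> (\<Sum>j=1..m. OPT m p n)"
    using S(3) by (intro sum_mono) auto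
  finally have "p_plus p n / real m \<le> OPT m p n"
    using m_ge2 by (simp add: field_simps)
  moreover have "3 * p_largest p n (2 * m + 1) \<le> OPT m p n"
  proof (cases "0 < p_largest p n (2 * m + 1)")
    case True
    define x where "x = p_largest p n (2 * m + 1)"
    have "2 * m + 1 \<le> card {j\<in>{1..n}. x \<le> p j}"
      using True le_p_largest_iff[of "2 * m + 1" x p n] by (simp add: x_def)
    \<comment> \<open>B is empty, so y is free; y = 2 * x makes both arguments of the minimum
      equal.\<close>
    then have "min (3 * x) (x + 2 * x) \<le> OPT m p n"
      using True by (intro pigeonhole_le_OPT[of "{}" "{j\<in>{1..n}. x \<le> p j}"]) (auto simp: x_def)
    then show ?thesis
      by (simp add: x_def)
  qed (use OPT_nonneg in linarith)
  ultimately show ?thesis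
    by (simp add: L_bound_def)
qed

end

section \<open>The number of migrations\<close>

context migration_setting
begin

text \<open>Describes the machine of job i as it was when i arrived. Later jobs have larger numbers,
  so they do not affect the sets of earlier jobs.\<close>

lemma arrival_load:
  assumes "arrival m \<alpha> p t S" "t \<le> n" "S i = Some j"
  shows "(small i i \<and> sum p {k. k < i \<and> S k = Some j \<and> small i k} \<le> b j * Ls i)
    \<or> (\<not> small i i \<and> sum p {k. k < i \<and> S k = Some j} \<le> L i)"
  using assms
proof (induction arbitrary: i j)
  case (arrival_small t S j')
  have dom: "k < Suc t" if "S k = Some l" for k l
    using domI[of S k l] that arrival_dom_ran(1)[OF arrival_small.hyps(1)] by simp
  show ?case
  proof (cases "i = Suc t")
    case True
    then have "{k. k < i \<and> (S(Suc t \<mapsto> j')) k = Some j \<and> small i k} = {k. S k = Some j' \<and> small (Suc t) k}"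
      using arrival_small.prems(2) dom by fastforce
    moreover have "j' = j"
      using arrival_small.prems(2) True by simp
    ultimately show ?thesis
      using arrival_small.hyps True by (simp add: admissible_def small_load_def del: fun_upd_apply)
  next
    case False
    then have "S i = Some j" "i < Suc t"
      using arrival_small.prems(2) dom by auto
    then have "{k. k < i \<and> (S(Suc t \<mapsto> j')) k = Some j \<and> P k} = {k. k < i \<and> S k = Some j \<and> P k}" for P
      by auto
    from this this[of "\<lambda>_. True"] show ?thesis
      using arrival_small.IH[OF _ \<open>S i = Some j\<close>] arrival_small.prems(1) by (simp del: fun_upd_apply)
  qed
next
  case (arrival_large t S j')
  have domS: "dom S = {1..t}"
    by (rule arrival_dom_ran(1)[OF arrival_large.hyps(1)])
  have dom: "k < Suc t" if "S k = Some l" for k l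
    using domI[of S k l] that domS by simp
  show ?case
  proof (cases "i = Suc t")
    case True
    then have "{k. k < i \<and> (S(Suc t \<mapsto> j')) k = Some j} = {k. S k = Some j'}"
      using arrival_large.prems(2) dom by auto
    moreover have "load p S j' \<le> L (Suc t)"
      using arrival_large.hyps(3) domS arrival_large.prems(1) by (intro least_loaded_le) auto
    moreover have "j' = j"
      using arrival_large.prems(2) True by simp
    ultimately show ?thesis
      using arrival_large.hyps True by (simp add: load_def del: fun_upd_apply)
  next
    case False
    then have "S i = Some j" "i < Suc t"
      using arrival_large.prems(2) dom by auto
    then have "{k. k < i \<and> (S(Suc t \<mapsto> j')) k = Some j \<and> P k} = {k. k < i \<and> S k = Some j \<and> P k}" for P
      by auto
    from this this[of "\<lambda>_. True"] show ?thesis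
      using arrival_large.IH[OF _ \<open>S i = Some j\<close>] arrival_large.prems(1) by (simp del: fun_upd_apply)
  qed
qed simp

text \<open>Any k jobs of U weigh at least k * c together, which covers the excess over x. If U has
  at most k jobs, all of U is taken.\<close>

lemma prune:
  assumes "Y \<subseteq> {1..n}" "U \<subseteq> Y" "\<And>u. u \<in> U \<Longrightarrow> c \<le> p u" "sum p Y \<le> x + real k * c"
  obtains D where "D \<subseteq> U" "card D \<le> k" "D = U \<or> sum p (Y - D) \<le> x"
proof (cases "card U \<le> k")
  case True
  then show ?thesis
    using that by blast
next
  case False
  then obtain D where D: "D \<subseteq> U" "card D = k"
    by (metis nat_le_linear obtain_subset_with_card_n)
  have "finite Y"
    using assms(1) finite_subset by blast
  have "real k * c \<le> sum p D"
    using D assms(3) sum_bounded_below[of D c p] by auto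
  moreover have "sum p (Y - D) = sum p Y - sum p D"
    using D assms(2) \<open>finite Y\<close> by (intro sum_diff) auto
  ultimately show ?thesis
    using that[of D] D assms(4) by auto
qed

text \<open>So many jobs of size (\<alpha> - 1)^2 * L are enough to lower a load L to (\<alpha> - 1)
  * L.\<close>

definition "N = nat \<lceil>(2 - \<alpha>) / (\<alpha> - 1)\<^sup>2\<rceil>"

lemma N_pos: "1 \<le> N"
proof -
  have "0 < (2 - \<alpha>) / (\<alpha> - 1)\<^sup>2"
    using alpha_le alpha_ge by simp
  then show ?thesis
    by (simp add: N_def Suc_le_eq)
qed

lemma one_le_N_mult: "1 \<le> (\<alpha> - 1) + real N * (\<alpha> - 1)\<^sup>2"
proof -
  have "(2 - \<alpha>) / (\<alpha> - 1)\<^sup>2 \<le> real N"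
    unfolding N_def by (rule real_nat_ceiling_ge)
  then have "2 - \<alpha> \<le> real N * (\<alpha> - 1)\<^sup>2"
    using alpha_ge by (simp add: pos_divide_le_eq)
  then show ?thesis
    by simp
qed

lemma L_le_N_mult:
  "L n \<le> (\<alpha> - 1) * L n + real N * ((\<alpha> - 1)\<^sup>2 * L n)"
  using mult_right_mono[OF one_le_N_mult L_nonneg[of n]] by (simp add: algebra_simps)

text \<open>
  \<open>A\<close> is the set of jobs on one machine after the arrival phase, and \<open>q\<close> its bound on the load
  of small jobs.
\<close>

lemma removable_set:
  assumes A: "A \<subseteq> {1..n}" and q: "0 \<le> q" "q \<le> \<alpha>"
    and arr: "\<And>i. i \<in> A \<Longrightarrow> (small i i \<and> sum p {k\<in>A. k < i \<and> small i k} \<le> q * Ls i)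
      \<or> (\<not> small i i \<and> sum p {k\<in>A. k < i} \<le> L i)"
  obtains D where "D \<subseteq> A" "card D \<le> N + 4"
    "sum p (A - D) \<le> max (q * Ls n) ((\<alpha> - 1) * L n)"
proof (cases "A = {}")
  case True
  have "0 \<le> (\<alpha> - 1) * L n"
    using alpha_ge L_nonneg[of n] by simp
  then show ?thesis
    using True that[of "{}"] by simp
next
  case False
  note witness = that
  define a where "a = \<alpha> - 1"
  have a: "1/3 \<le> a" "a \<le> 1/2"
    using alpha_ge alpha_le by (auto simp: a_def)
  have finA: "finite A"
    using A finite_subset by blast
  have le_n: "i \<le> n" "1 \<le> i" if "i \<in> A" for i
    using A that by auto
  have Lpos: "0 < L i" if "i \<in> A" for i
    using L_pos le_n that by blast
  define last where "last = Max A"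
  have last: "last \<in> A" "\<And>i. i \<in> A \<Longrightarrow> i \<le> last"
    using finA False by (auto simp: last_def)
  have Ln: "0 < L n" "L i \<le> L n" if "i \<in> A" for i
    using L_pos[of n] L_mono[of i n] le_n[OF that] by auto
  define Ln where "Ln = L n"
  have Ln_pos: "0 < Ln"
    using Ln(1) last(1) by (simp add: Ln_def)
  let ?B = "max (q * Ls n) (a * Ln)"
  let ?pre = "\<lambda>i. {k\<in>A. k < i}"
  have pre_le: "sum p (?pre i) \<le> L i" "a * L i < p i" if "i \<in> A" "\<not> small i i" for i
    using arr[OF that(1)] that(2) by (auto simp: small_at_def a_def)
  have mono: "sum p X \<le> sum p Y" if "X \<subseteq> Y" "Y \<subseteq> A" for X Y
    using that A by (intro sum_p_mono) auto
  have NL: "Ln \<le> a * Ln + real N * (a\<^sup>2 * Ln)"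
    using L_le_N_mult by (simp add: a_def Ln_def)
  have big: "a\<^sup>2 * Ln \<le> p i" if "i \<in> A" "\<not> small i i" "a * Ln \<le> L i" for i
  proof -
    have "a * (a * Ln) \<le> a * L i"
      using that(3) a by (intro mult_left_mono) auto
    then show ?thesis
      using pre_le(2)[OF that(1,2)] by (simp add: power2_eq_square)
  qed
  have goal: thesis if "D \<subseteq> A" "card D \<le> N + 4" "sum p (A - D) \<le> ?B" for D
    using witness[of D] that by (simp add: a_def Ln_def)
  \<comment> \<open>The last job that was small on arrival; 0 stands for none, since jobs are
    numbered from 1.\<close>
  define l where "l = Max (insert 0 {i\<in>A. small i i})"
  have "l \<in> insert 0 {i\<in>A. small i i}"
    unfolding l_def using finA by (intro Max_in) auto
  then have l: "l = 0 \<or> (l \<in> A \<and> small l l)"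
    by auto
  have after: "\<not> small i i" if "i \<in> A" "l < i" for i
    using that finA Max_ge[of "insert 0 {i\<in>A. small i i}" i] unfolding l_def[symmetric] by auto
  \<comment> \<open>Later jobs that arrived while \<open>L\<close> was still below a *
    \<open>Ln\<close>. Jobs after l outside T have size at least a^2 * \<open>Ln\<close>.\<close>
  define T where "T = {i\<in>A. l < i \<and> L i < a * Ln}"
  show thesis
  proof (cases "T = {}")
    case False
    define t where "t = Max T"
    have "finite T"
      using finA by (simp add: T_def)
    then have "t \<in> T" "\<And>i. i \<in> T \<Longrightarrow> i \<le> t"
      using False by (auto simp: t_def)
    then have t: "t \<in> A" "l < t" "L t < a * Ln" "\<And>i. i \<in> A \<Longrightarrow> t < i \<Longrightarrow> a * Ln \<le> L i"
      by (force simp: T_def not_less[symmetric])+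
    have pre_t: "sum p (?pre t) \<le> a * Ln"
      using pre_le(1)[OF t(1) after[OF t(1,2)]] t(3) by simp
    let ?U = "{i\<in>A. t < i \<and> i < last}"
    \<comment> \<open>The last job t of T found a load below a * \<open>Ln\<close>. Hence t,
      \<open>last\<close> and at most N of the jobs in between suffice.\<close>
    obtain D where D: "D \<subseteq> ?U" "card D \<le> N" "D = ?U \<or> sum p (?pre last - D) \<le> a * Ln"
    proof (rule prune[of "?pre last" ?U "a\<^sup>2 * Ln" "a * Ln" N])
      show "a\<^sup>2 * Ln \<le> p u" if "u \<in> ?U" for u
        using that t after big by auto
      have "l < last"
        using t(2) last(2)[OF t(1)] by simp
      then show "sum p (?pre last) \<le> a * Ln + real N * (a\<^sup>2 * Ln)"
        using pre_le(1)[OF last(1) after[OF last(1)]] Ln(2)[OF last(1)] NL by (simp add: Ln_def)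
    qed (use A in auto)
    show thesis
    proof (rule goal[of "D \<union> {last, t}"])
      show "D \<union> {last, t} \<subseteq> A"
        using D last t by auto
      have "card (D \<union> {last, t}) \<le> card D + card {last, t}"
        by (rule card_Un_le)
      also have "card {last, t} \<le> 2"
        by (simp add: card_insert_if)
      finally show "card (D \<union> {last, t}) \<le> N + 4"
        using D(2) by simp
      have "sum p (A - (D \<union> {last, t})) \<le> a * Ln"
      proof (cases "D = ?U")
        case True
        have "A - (D \<union> {last, t}) \<subseteq> ?pre t"
        proof
          fix k assume "k \<in> A - (D \<union> {last, t})"
          then have k: "k \<in> A" "\<not> (t < k \<and> k < last)" "k \<noteq> last" "k \<noteq> t"
            unfolding True by auto
          have "k < t"
            using k(2-4) last(2)[OF k(1)] by linarith
          with k(1) show "k \<in> ?pre t"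
            by simp
        qed
        then have "sum p (A - (D \<union> {last, t})) \<le> sum p (?pre t)"
          by (rule mono) auto
        then show ?thesis
          using pre_t by simp
      next
        case False
        have "A - (D \<union> {last, t}) \<subseteq> ?pre last - D"
          using last(2) by (auto simp: le_less)
        then have "sum p (A - (D \<union> {last, t})) \<le> sum p (?pre last - D)"
          by (intro mono) auto
        with False D(3) show ?thesis
          by simp
      qed
      then show "sum p (A - (D \<union> {last, t})) \<le> ?B"
        by simp
    qed
  next
    case True
    then have T: "a * Ln \<le> L i" if "i \<in> A" "l < i" for i
      using that by (auto simp: T_def not_less[symmetric])
    let ?U = "{i\<in>A. l < i \<and> i < last}"
    have U: "a\<^sup>2 * Ln \<le> p u" if "u \<in> ?U" for u
      using that T after big by auto
    have pre_last: "sum p (?pre last) \<le> Ln" if "l < last"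
      using pre_le(1)[OF last(1) after[OF last(1) that]] Ln(2)[OF last(1)] by (simp add: Ln_def)
    have card_add: "card (D \<union> X) \<le> k + k'" if "card D \<le> k" "card X \<le> k'" for D X :: "nat set" and k k'
      using that card_Un_le[of D X] by linarith
    show thesis
    proof (cases "l = 0")
      case True
      have "0 < last"
        using le_n(2)[OF last(1)] by simp
      obtain D where D: "D \<subseteq> ?U" "card D \<le> N" "D = ?U \<or> sum p (?pre last - D) \<le> a * Ln"
        by (rule prune[of "?pre last" ?U "a\<^sup>2 * Ln" "a * Ln" N])
           (use A U pre_last NL True \<open>0 < last\<close> in auto)
      have "A - (D \<union> {last}) = ?pre last - D"
        using last(2) by (auto simp: le_less)
      \<comment> \<open>With l = 0 every job before \<open>last\<close> lies in \<open>?U\<close>,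
        so taking all of \<open>?U\<close> leaves nothing.\<close>
      moreover have "?pre last - ?U = {}"
        using le_n(2) True by (auto simp: Suc_le_eq)
      ultimately have "sum p (A - (D \<union> {last})) \<le> a * Ln"
        using D(3) a Ln_pos by (metis sum.empty mult_nonneg_nonneg less_imp_le order.trans zero_le_divide_1_iff zero_le_numeral)
      moreover have "card (D \<union> {last}) \<le> N + 4"
        using card_add[OF D(2), of "{last}" 1] by simp
      moreover have "D \<union> {last} \<subseteq> A"
        using D(1) last(1) by auto
      ultimately show thesis
        using goal[of "D \<union> {last}"] by simp
    next
      case False
      with l have lA: "l \<in> A" "small l l"
        by auto
      \<comment> \<open>The jobs before l split into those large at time l and those still counted
        in the small load that the arrival of l bounds.\<close>
      define Q where "Q = {i\<in>A. i < l \<and> \<not> small l i}"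
      define s where "s = sum p {i\<in>A. i < l \<and> small l i}"
      have Q: "Q \<subseteq> A" "finite Q" "l \<notin> Q"
        using finA by (auto simp: Q_def)
      have s_le: "s \<le> q * Ls l"
        using arr[OF lA(1)] lA(2) by (simp add: s_def)
      have Lsl: "Ls l \<le> Ls n" "Ls l \<le> L l" "0 \<le> Ls l"
        using L_star_mono[of l n] L_star_le_L[of l] L_star_nonneg[of l] le_n[OF lA(1)] by auto
      have "s \<le> q * Ls n"
        using s_le Lsl(1) q(1) mult_left_mono[of "Ls l" "Ls n" q] by linarith
      have "s \<le> \<alpha> * L l"
        using s_le mult_mono[of q \<alpha> "Ls l" "L l"] Lsl q alpha_ge by linarith
      have pQ: "a * L l < p i" if "i \<in> Q" for i
        using that by (simp add: Q_def small_at_def a_def)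
      have cardQ: "card Q \<le> 3"
      proof (rule ccontr)
        assume "\<not> card Q \<le> 3"
        then have "Q \<noteq> {}"
          by auto
        \<comment> \<open>If Q had four jobs, its last one r would have found at least three of size
          above \<open>L l\<close> / 3. But r was large on arrival, so the load before it was at
          most \<open>L r\<close> \<le> \<open>L l\<close>.\<close>
        define r where "r = Max Q"
        have r: "r \<in> Q" "\<And>i. i \<in> Q \<Longrightarrow> i \<le> r"
          using Q(2) \<open>Q \<noteq> {}\<close> by (auto simp: r_def)
        then have rA: "r \<in> A" "r \<le> l" "\<not> small r r"
          using small_mono[of r r l] le_n[OF lA(1)] by (auto simp: Q_def)
        have "card (Q - {r}) \<noteq> 0"
          using \<open>\<not> card Q \<le> 3\<close> Q(2) r(1) by simp
        then have ne: "Q - {r} \<noteq> {}"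
          by (metis card.empty)
        have "L l \<le> 3 * (a * L l)"
          using a Lpos[OF lA(1)] mult_right_mono[of 1 "3 * a" "L l"] by simp
        also have "\<dots> \<le> real (card (Q - {r})) * (a * L l)"
          using \<open>\<not> card Q \<le> 3\<close> Q(2) r(1) a Lpos[OF lA(1)] by (intro mult_right_mono) auto
        also have "\<dots> = (\<Sum>i\<in>Q - {r}. a * L l)"
          by simp
        also have "\<dots> < sum p (Q - {r})"
          using ne Q(2) pQ by (intro sum_strict_mono) auto
        also have "\<dots> \<le> sum p (?pre r)"
          using r Q(1) by (intro mono) (auto simp: le_less)
        also have "\<dots> \<le> L r"
          by (rule pre_le(1)[OF rA(1,3)])
        also have "\<dots> \<le> L l"
          using rA le_n[OF lA(1)] by (intro L_mono) auto
        finally show False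
          by simp
      qed
      have rest: "sum p (A - (Q \<union> {l} \<union> {i\<in>A. l < i})) \<le> ?B"
      proof -
        have "A - (Q \<union> {l} \<union> {i\<in>A. l < i}) = {i\<in>A. i < l \<and> small l i}"
          by (auto simp: Q_def)
        then show ?thesis
          using \<open>s \<le> q * Ls n\<close> by (simp add: s_def)
      qed
      show thesis
      proof (cases "l = last")
        case True
        then have E: "{i\<in>A. l < i} = {}"
          using last(2) by (auto simp: not_less)
        show thesis
        proof (rule goal)
          show "sum p (A - (Q \<union> {l})) \<le> ?B"
            using rest unfolding E by simp
        qed (use Q(1) lA card_add[OF cardQ, of "{l}" 1] in auto)
      next
        case False
        then have "l < last"
          using last(2) lA by (auto simp: le_less)
        show thesis
        \<comment> \<open>If the jobs up to l fit below a * \<open>Ln\<close>, they all stay and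
          only later jobs are pruned.\<close>
        proof (cases "sum p {i\<in>A. i \<le> l} \<le> a * Ln")
          case True
          obtain D where D: "D \<subseteq> ?U" "card D \<le> N" "D = ?U \<or> sum p (?pre last - D) \<le> a * Ln"
            by (rule prune[of "?pre last" ?U "a\<^sup>2 * Ln" "a * Ln" N])
               (use A U pre_last[OF \<open>l < last\<close>] NL in auto)
          have eq: "A - (D \<union> {last}) = ?pre last - D"
            using last(2) by (auto simp: le_less)
          have "?pre last - ?U = {i\<in>A. i \<le> l}"
            using \<open>l < last\<close> by auto
          then have "sum p (A - (D \<union> {last})) \<le> a * Ln"
            using D(3) eq True by metis
          moreover have "card (D \<union> {last}) \<le> N + 4"
            using card_add[OF D(2), of "{last}" 1] by simp
          moreover have "D \<union> {last} \<subseteq> A"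
            using D(1) last(1) by auto
          ultimately show thesis
            using goal[of "D \<union> {last}"] by simp
        next
          case False
          let ?Y = "?pre last - (Q \<union> {l})"
          have Ysub: "?Y \<subseteq> {1..n}" "?U \<subseteq> ?Y"
            using A by (auto simp: Q_def)
          have sumQl: "sum p (Q \<union> {l}) = sum p Q + p l"
            using Q by simp
          \<comment> \<open>With three large jobs before \<open>l\<close>, removing these and \<open>l\<close> saves one of the \<open>N\<close> later
            removals.\<close>
          have save: "a\<^sup>2 * Ln \<le> sum p (Q \<union> {l})" if "card Q = 3"
          proof (rule ccontr)
            assume less: "\<not> a\<^sup>2 * Ln \<le> sum p (Q \<union> {l})"
            have "sum p {i\<in>A. i \<le> l} = s + sum p (Q \<union> {l})"
            proof -
              have "{i\<in>A. i \<le> l} = {i\<in>A. i < l \<and> small l i} \<union> (Q \<union> {l})"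
                using lA by (auto simp: Q_def)
              moreover have "{i\<in>A. i < l \<and> small l i} \<inter> (Q \<union> {l}) = {}"
                by (auto simp: Q_def)
              ultimately show ?thesis
                unfolding s_def using finA Q(2) by (simp only:) (rule sum.union_disjoint, auto)
            qed
            \<comment> \<open>The jobs up to l exceed a * \<open>Ln\<close>, so s must be more than
              (a - a^2) * \<open>Ln\<close>. As s \<le> (1 + a) * \<open>L l\<close>, while three
              jobs above a * \<open>L l\<close> force 3 * \<open>L l\<close> < a *
              \<open>Ln\<close>, this would give a > 1/2.\<close>
            with False less have "(a - a\<^sup>2) * Ln < s"
              by (simp add: algebra_simps)
            with \<open>s \<le> \<alpha> * L l\<close> have 1: "(a - a\<^sup>2) * Ln < (1 + a) * L l"
              by (simp add: a_def)
            have "3 * (a * L l) \<le> sum p Q"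
              using sum_bounded_below[of Q "a * L l" p] pQ that by (simp add: less_imp_le)
            moreover have "0 < p l"
              using A lA p_pos by auto
            ultimately have "3 * (a * L l) < a\<^sup>2 * Ln"
              using less sumQl by linarith
            then have 2: "3 * L l < a * Ln"
              using a by (simp add: power2_eq_square)
            have "(1 + a) * (3 * L l) \<le> (1 + a) * (a * Ln)"
              using a 2 by (intro mult_left_mono) auto
            with 1 have "3 * ((a - a\<^sup>2) * Ln) < (1 + a) * (a * Ln)"
              by linarith
            then have "(3 * (1 - a)) * (a * Ln) < (1 + a) * (a * Ln)"
              by (simp add: algebra_simps power2_eq_square)
            then have "3 * (1 - a) < 1 + a"
              using a Ln_pos by (simp add: mult_less_cancel_right)
            with a(2) show False
              by simp
          qed
          \<comment> \<open>Together with l and \<open>last\<close> this keeps the count at N + 4: k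
            = N if Q has at most two jobs, and k = N - 1 if it has three.\<close>
          obtain k where k: "k + card Q \<le> N + 2" "sum p ?Y \<le> a * Ln + real k * (a\<^sup>2 * Ln)"
          proof (cases "card Q = 3")
            case True
            have "sum p ?Y = sum p (?pre last) - sum p (Q \<union> {l})"
              using finA Q lA \<open>l < last\<close> by (intro sum_diff) (auto simp: Q_def)
            then have "sum p ?Y \<le> a * Ln + real (N - 1) * (a\<^sup>2 * Ln)"
              using save[OF True] pre_last[OF \<open>l < last\<close>] NL N_pos by (simp add: of_nat_diff algebra_simps)
            then show ?thesis
              using True N_pos by (intro that[of "N - 1"]) auto
          next
            case False
            have "sum p ?Y \<le> sum p (?pre last)"
              by (intro mono) auto
            then show ?thesis
              using False cardQ pre_last[OF \<open>l < last\<close>] NL by (intro that[of N]) auto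
          qed
          obtain D where D: "D \<subseteq> ?U" "card D \<le> k" "D = ?U \<or> sum p (?Y - D) \<le> a * Ln"
            by (rule prune[of ?Y ?U "a\<^sup>2 * Ln" "a * Ln" k]) (use Ysub U k(2) in auto)
          let ?D = "(D \<union> Q) \<union> {l, last}"
          have eq: "A - ?D = ?Y - D"
            using last(2) by (auto simp: le_less)
          have "?Y - ?U = A - (Q \<union> {l} \<union> {i\<in>A. l < i})"
            using \<open>l < last\<close> by auto
          then have "sum p (A - ?D) \<le> ?B"
            using D(3) eq rest by (metis max.coboundedI2)
          moreover have "card ?D \<le> (k + card Q) + 2"
            using D(2) card_insert_le_m1[of 2 "{last}" l] by (intro card_add) auto
          then have "card ?D \<le> N + 4"
            using k(1) by linarith
          moreover have "?D \<subseteq> A"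
            using D(1) last(1) lA(1) Q(1) by auto
          ultimately show thesis
            using goal[of ?D] by simp
        qed
      qed
    qed
  qed
qed

text \<open>On each machine the set from \<open>removable_set\<close> competes with the removal
  rule; the bounds are added over all machines.\<close>

lemma card_removed_le:
  assumes "arrival m \<alpha> p n S\<^sub>0" "removal m \<alpha> p n S\<^sub>0 S R"
  shows "card R \<le> (N + 4) * m"
proof -
  have dom: "dom S\<^sub>0 = {1..n}" and ran: "ran S\<^sub>0 \<subseteq> {1..m}"
    using arrival_dom_ran[OF assms(1)] by auto
  have R: "R \<subseteq> dom S\<^sub>0"
    by (rule removal_eq(1)[OF assms(2)])
  have "card (R \<inter> {i. S\<^sub>0 i = Some j}) \<le> N + 4" if j: "j \<in> {1..m}" for j
  proof -
    let ?A = "{i. S\<^sub>0 i = Some j}"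
    have eq: "{k\<in>?A. k < i \<and> P k} = {k. k < i \<and> S\<^sub>0 k = Some j \<and> P k}" for i P
      by auto
    obtain D where D: "D \<subseteq> ?A" "card D \<le> N + 4" "sum p (?A - D) \<le> max (b j * Ls n) ((\<alpha> - 1) * L n)"
    proof (rule removable_set[of ?A "b j"])
      show "?A \<subseteq> {1..n}"
        unfolding dom[symmetric] by auto
      show "(small i i \<and> sum p {k\<in>?A. k < i \<and> small i k} \<le> b j * Ls i)
          \<or> (\<not> small i i \<and> sum p {k\<in>?A. k < i} \<le> L i)" if "i \<in> ?A" for i
        using arrival_load[OF assms(1), of i j] that eq[of i] eq[of i "\<lambda>_. True"] by simp
    qed (use beta_pos[OF j] beta_le[OF j] in auto)
    have "card (R \<inter> ?A) \<le> card D"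
      using dom by (intro removal_card_le[OF assms(2) _ D(1,3)]) simp
    with D(2) show ?thesis
      by simp
  qed
  then have "(\<Sum>j=1..m. card (R \<inter> {i. S\<^sub>0 i = Some j})) \<le> (\<Sum>j=1..m. N + 4)"
    by (intro sum_mono) auto
  moreover have "R = (\<Union>j\<in>{1..m}. R \<inter> {i. S\<^sub>0 i = Some j})"
    using R ran by (fastforce simp: ran_def)
  then have "card R \<le> (\<Sum>j=1..m. card (R \<inter> {i. S\<^sub>0 i = Some j}))"
    using card_UN_le[of "{1..m}" "\<lambda>j. R \<inter> {i. S\<^sub>0 i = Some j}"] by simp
  ultimately show ?thesis
    by (simp add: mult.commute)
qed

end

section \<open>The makespan\<close>

context migration_setting
begin

section \<open>Greedy assignment of job sets\<close>

lemma load_assign_set_le: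
  assumes "dom S \<subseteq> {1..n}" "B \<subseteq> {1..n}"
  shows "load p (assign_set B j S) k \<le> load p S k + (if k = j then sum p B else 0)"
proof -
  let ?A = "{i. S i = Some k}"
  have A: "?A \<subseteq> {1..n}"
    using assms(1) by auto
  show ?thesis
  proof (cases "k = j")
    case True
    then have "{i. assign_set B j S i = Some k} = ?A \<union> B"
      by (auto simp: assign_set_def)
    moreover have "finite ?A" "finite B"
      using A assms(2) finite_subset by blast+
    moreover have "0 \<le> sum p (?A \<inter> B)"
      using assms(2) by (intro sum_p_nonneg) auto
    ultimately show ?thesis
      using True by (simp add: load_def sum_Un)
  next
    case False
    then have "{i. assign_set B j S i = Some k} \<subseteq> ?A"
      by (auto simp: assign_set_def)
    then show ?thesis
      using False A by (simp add: load_def sum_p_mono)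
  qed
qed

lemma dom_assign_set: "dom (assign_set B j S) = dom S \<union> B"
  by (auto simp: assign_set_def dom_def)

text \<open>
  \<open>T\<close> contains the machines that received a set so far. As at most \<open>k\<close> machines did,
  one of the machines \<open>1, \<dots>, k + 1\<close> still obeys its initial load bound.
\<close>

lemma greedy_sets_load_le:
  assumes "greedy m p Bs S S'" "dom S \<subseteq> {1..n}" "\<And>B. B \<in> set Bs \<Longrightarrow> B \<subseteq> {1..n}"
    and "finite T" "card T \<le> k" "k + length Bs \<le> m"
    and "\<And>j. j \<in> {1..m} - T \<Longrightarrow> load p S j \<le> c j" "\<And>j. j \<in> T \<Longrightarrow> load p S j \<le> W"
    and "\<And>j. j \<in> {1..m} \<Longrightarrow> c j \<le> W"
    and "\<And>i j. i < length Bs \<Longrightarrow> j \<in> {1..Suc (k + i)} \<Longrightarrow> c j + sum p (Bs ! i) \<le> W"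
    and "j \<in> {1..m}"
  shows "load p S' j \<le> W"
  using assms
proof (induction arbitrary: T k j)
  case (greedy_Nil S)
  show ?case
  proof (cases "j \<in> T")
    case False
    then have "load p S j \<le> c j"
      using greedy_Nil.prems(6,10) by blast
    also have "\<dots> \<le> W"
      using greedy_Nil.prems(8,10) by blast
    finally show ?thesis .
  qed (rule greedy_Nil.prems(7))
next
  case (greedy_Cons S j\<^sub>0 Bs B S' T k)
  have "\<not> {1..Suc k} \<subseteq> T"
  proof
    assume "{1..Suc k} \<subseteq> T"
    then have "card {1..Suc k} \<le> card T"
      using greedy_Cons.prems(3) by (intro card_mono)
    then show False
      using greedy_Cons.prems(4) by simp
  qed
  then obtain j' where j': "j' \<in> {1..Suc k}" "j' \<notin> T"
    by blast
  have "j' \<in> {1..m}"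
    using j'(1) greedy_Cons.prems(5) by auto
  then have "load p S j\<^sub>0 \<le> load p S j'"
    using greedy_Cons.hyps(1) by (simp add: least_loaded_def)
  also have "\<dots> \<le> c j'"
    using j' \<open>j' \<in> {1..m}\<close> by (intro greedy_Cons.prems(6)) auto
  finally have j0: "load p S j\<^sub>0 + sum p B \<le> W"
    using greedy_Cons.prems(9)[of 0 j'] j'(1) by simp
  have B: "B \<subseteq> {1..n}"
    using greedy_Cons.prems(2) by simp
  note le = load_assign_set_le[OF greedy_Cons.prems(1) B, of j\<^sub>0]
  show ?case
  proof (rule greedy_Cons.IH[of "insert j\<^sub>0 T" "Suc k"])
    show "dom (assign_set B j\<^sub>0 S) \<subseteq> {1..n}"
      using greedy_Cons.prems(1) B by (simp add: dom_assign_set)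
    show "card (insert j\<^sub>0 T) \<le> Suc k"
      using greedy_Cons.prems(3,4) by (simp add: card_insert_if)
    show "load p (assign_set B j\<^sub>0 S) j \<le> c j" if "j \<in> {1..m} - insert j\<^sub>0 T" for j
      using le[of j] greedy_Cons.prems(6)[of j] that by simp
    show "load p (assign_set B j\<^sub>0 S) j \<le> W" if "j \<in> insert j\<^sub>0 T" for j
      using le[of j] j0 greedy_Cons.prems(7)[of j] that by (cases "j = j\<^sub>0") auto
    show "c j + sum p (Bs ! i) \<le> W" if "i < length Bs" "j \<in> {1..Suc (Suc k + i)}" for i j
      using greedy_Cons.prems(9)[of "Suc i" j] that by simp
  qed (use greedy_Cons.prems in auto)
qed

text \<open>By averaging, the receiving machine has load at most \<open>L n\<close> at every
  step.\<close>

lemma greedy_load_le: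
  assumes "greedy m p Bs S S'" "dom S \<subseteq> {1..n}"
    and "\<And>B. B \<in> set Bs \<Longrightarrow> B \<subseteq> {1..n} \<and> L n + sum p B \<le> W"
    and "\<And>j. j \<in> {1..m} \<Longrightarrow> load p S j \<le> W" "j \<in> {1..m}"
  shows "load p S' j \<le> W"
  using assms
proof (induction arbitrary: j)
  case (greedy_Cons S j\<^sub>0 Bs B S')
  have B: "B \<subseteq> {1..n}" "L n + sum p B \<le> W"
    using greedy_Cons.prems(2) by auto
  have "load p S j\<^sub>0 \<le> L n"
    using least_loaded_le[OF greedy_Cons.hyps(1) greedy_Cons.prems(1)] by simp
  with B(2) have j0: "load p S j\<^sub>0 + sum p B \<le> W"
    by simp
  note le = load_assign_set_le[OF greedy_Cons.prems(1) B(1), of j\<^sub>0]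
  show ?case
  proof (rule greedy_Cons.IH)
    show "dom (assign_set B j\<^sub>0 S) \<subseteq> {1..n}"
      using greedy_Cons.prems(1) B by (simp add: dom_assign_set)
    show "load p (assign_set B j\<^sub>0 S) j \<le> W" if "j \<in> {1..m}" for j
      using le[of j] j0 greedy_Cons.prems(3)[OF that] by (cases "j = j\<^sub>0") auto
  qed (use greedy_Cons.prems in auto)
qed simp

section \<open>Pairing the large removed jobs\<close>

lemma ranked_pair_le_OPT:
  assumes "distinct rs" "set rs \<subseteq> {1..n}" "sorted_wrt (\<lambda>x y. p x \<ge> p y) rs"
    and "i \<in> {1..m}" "2 * m - i < length rs"
  shows "min (3 * p (rs ! (2 * m - i))) (p (rs ! (2 * m - i)) + p (rs ! (i - 1))) \<le> OPT m p n"
proof -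
  \<comment> \<open>Ranks 1 to i get weight 2 and ranks i + 1 to 2 * m + 1 - i weight 1, in total 2
    * m + 1. List positions are ranks minus 1.\<close>
  let ?B = "(!) rs ` {..<i}" and ?C = "(!) rs ` {i..<2 * m + 1 - i}"
  have ge: "p (rs ! l) \<le> p (rs ! k)" if "k \<le> l" "l < length rs" for k l
    using that sorted_wrt_nth_less[OF assms(3), of k l] by (cases "k = l") auto
  have sub: "?B \<subseteq> set rs" "?C \<subseteq> set rs"
    using assms(4,5) by auto
  have "inj_on ((!) rs) {..<i}" "inj_on ((!) rs) {i..<2 * m + 1 - i}"
    using assms(1,4,5) by (auto intro!: inj_on_nth)
  then have "card ?B = i" "card ?C = 2 * m + 1 - i - i"
    by (simp_all add: card_image)
  then have card: "2 * m < 2 * card ?B + card ?C"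
    using assms(4) by auto
  show ?thesis
  proof (rule pigeonhole_le_OPT[of ?B ?C])
    show "?B \<inter> ?C = {}"
      using assms(1,4,5) by (auto simp: nth_eq_iff_index_eq)
    show "p (rs ! (i - 1)) \<le> p k" if "k \<in> ?B" for k
      using that assms(4,5) ge by auto
    show "p (rs ! (2 * m - i)) \<le> p k" if "k \<in> ?C" for k
      using that assms(4,5) ge by auto
    show "p (rs ! (2 * m - i)) \<le> p (rs ! (i - 1))"
      using assms(4,5) by (intro ge) auto
    have "rs ! (2 * m - i) \<in> {1..n}"
      using assms(2,5) nth_mem by blast
    then show "0 \<le> p (rs ! (2 * m - i))"
      by (simp add: less_imp_le p_pos)
  qed (use sub assms(2) card in blast)+
qed

lemma pair_set_eq:
  assumes "i \<in> {1..m}"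
  shows "pair_set m p rs i = (if i - 1 < length rs then {rs ! (i - 1)} else {}) \<union>
    (if 2 * m - i < length rs \<and> p (rs ! (2 * m - i)) > p (rs ! (i - 1)) / 2
     then {rs ! (2 * m - i)} else {})"
proof -
  have "i \<le> length rs \<longleftrightarrow> i - 1 < length rs" "2 * m + 1 - i \<le> length rs \<longleftrightarrow> 2 * m - i < length rs"
    using assms by auto
  moreover have "2 * m + 1 - i - 1 = 2 * m - i"
    by simp
  ultimately show ?thesis
    unfolding pair_set_def by (simp only:)
qed

lemma pair_set_subset: "i \<in> {1..m} \<Longrightarrow> pair_set m p rs i \<subseteq> set rs"
  by (auto simp: pair_set_eq)

text \<open>The ranks i lie in the first m, their partners 2 * m + 1 - i beyond m, and both maps are
  injective.\<close>

lemma pair_set_disjoint: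
  assumes "distinct rs" "i \<in> {1..m}" "k \<in> {1..m}" "i \<noteq> k"
  shows "pair_set m p rs i \<inter> pair_set m p rs k = {}"
  using assms by (auto simp: pair_set_eq nth_eq_iff_index_eq split: if_splits)

text \<open>In a true pair the smaller job x exceeds half of the larger y, so x + y is the minimum
  of 3 * x and x + y. A single job is at most the optimum anyway.\<close>

lemma sum_pair_set_le_OPT:
  assumes "distinct rs" "set rs \<subseteq> {1..n}" "sorted_wrt (\<lambda>x y. p x \<ge> p y) rs" "i \<in> {1..m}"
  shows "sum p (pair_set m p rs i) \<le> OPT m p n"
proof (cases "2 * m - i < length rs \<and> p (rs ! (2 * m - i)) > p (rs ! (i - 1)) / 2")
  case True
  then have "i - 1 < length rs" "rs ! (i - 1) \<noteq> rs ! (2 * m - i)"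
    using assms(1,4) by (auto simp: nth_eq_iff_index_eq)
  then have "sum p (pair_set m p rs i) = p (rs ! (2 * m - i)) + p (rs ! (i - 1))"
    using True assms(4) by (simp add: pair_set_eq)
  then show ?thesis
    using ranked_pair_le_OPT[OF assms] True by (auto simp: min_def split: if_splits)
next
  case False
  then have eq: "pair_set m p rs i = (if i - 1 < length rs then {rs ! (i - 1)} else {})"
    using assms(4) by (auto simp: pair_set_eq)
  show ?thesis
  proof (cases "i - 1 < length rs")
    case True
    then have "rs ! (i - 1) \<in> {1..n}"
      using assms(2) nth_mem by blast
    then show ?thesis
      unfolding eq using True p_le_OPT by simp
  qed (simp add: eq OPT_nonneg)
qed

text \<open>A large job left out of all sets is at most half of its partner y, so here the minimum
  is 3 * x.\<close>

lemma leftover_le_OPT: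
  assumes "distinct rs" "set rs \<subseteq> {1..n}" "sorted_wrt (\<lambda>x y. p x \<ge> p y) rs" "length rs \<le> 2 * m"
    and "x \<in> set rs" "\<And>i. i \<in> {1..m} \<Longrightarrow> x \<notin> pair_set m p rs i"
  shows "3 * p x \<le> OPT m p n"
proof -
  obtain k where k: "k < length rs" "x = rs ! k"
    using assms(5) by (auto simp: in_set_conv_nth)
  have "m \<le> k"
  proof (rule ccontr)
    assume "\<not> m \<le> k"
    then show False
      using assms(6)[of "Suc k"] k by (simp add: pair_set_eq)
  qed
  \<comment> \<open>The partner rank: position k is rank k + 1 = 2 * m + 1 - i. Ranks up to m are
    always in a set, so k \<ge> m.\<close>
  define i where "i = 2 * m - k"
  have i: "i \<in> {1..m}" "2 * m - i = k"
    using k(1) \<open>m \<le> k\<close> assms(4) by (auto simp: i_def)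
  have "p x \<le> p (rs ! (i - 1)) / 2"
    using assms(6)[OF i(1)] k i by (auto simp: pair_set_eq split: if_splits)
  then show ?thesis
    using ranked_pair_le_OPT[OF assms(1-3) i(1)] i(2) k by (auto simp: min_def split: if_splits)
qed

section \<open>Combining the two greedy stages\<close>

lemma sum_large_le: "real m * Ls n + sum p {i\<in>{1..n}. \<not> small n i} \<le> real m * L n"
proof -
  have "sum p {i\<in>{1..n}. small n i} + sum p {i\<in>{1..n}. \<not> small n i} = p_plus p n"
    unfolding p_plus_def by (subst sum.union_disjoint[symmetric]) (auto intro: sum.cong)
  then show ?thesis
    using p_plus_le_L[of n] by (simp add: L_star_eq)
qed

text \<open>The claim is affine in \<open>x\<close>, so it suffices that it holds for \<open>x = 0\<close> and \<open>x = C\<close>.\<close>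

lemma beta_L_star_add_le:
  assumes "j \<in> {1..k}" "k \<le> m" "0 \<le> x" "x \<le> C" "real m * Ls n + real k * x \<le> real m * C"
  shows "b j * Ls n + x \<le> \<alpha> * C"
proof -
  have j: "j \<in> {1..m}"
    using assms(1,2) by simp
  have "b j * (real m - real k) \<le> b j * (real m - real j)"
    using assms(1) beta_pos[OF j] by (intro mult_left_mono) auto
  also have "\<dots> \<le> (\<alpha> - 1) * real m"
    by (rule beta_mult_gap_le[OF j])
  finally have "b j * (real m - real k) * x \<le> (\<alpha> - 1) * real m * x"
    using assms(3) by (rule mult_right_mono)
  moreover have "b j * (real m * (C - x)) \<le> \<alpha> * (real m * (C - x))"
    using assms(4) beta_le[OF j] by (intro mult_right_mono) auto
  moreover have "b j * (real m * Ls n + real k * x) \<le> b j * (real m * C)"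
    using assms(5) beta_pos[OF j] by (intro mult_left_mono) auto
  \<comment> \<open>The bound m * C - k * x on m * \<open>Ls n\<close> is written as m * (C - x) +
    (m - k) * x; multiplied by \<open>b j\<close>, the parts are at most \<alpha> * m * (C - x) and
    (\<alpha> - 1) * m * x.\<close>
  ultimately have "real m * (b j * Ls n + x) \<le> real m * (\<alpha> * C)"
    by (simp add: algebra_simps)
  then show ?thesis
    using m_ge2 by simp
qed

lemma reassignment_complete:
  assumes "dom S\<^sub>1 \<union> R = {1..n}" "ran S\<^sub>1 \<subseteq> {1..m}" "reassignment m \<alpha> p n R S\<^sub>1 S"
  shows "S \<in> complete_schedules m n"
proof -
  from assms(3) obtain rs Ps qs S\<^sub>P where rs: "set rs = {i \<in> R. p i > (\<alpha> - 1) * L n}"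
    and Ps: "mset Ps = mset (map (pair_set m p rs) [1..<Suc m])"
    and gP: "greedy m p Ps S\<^sub>1 S\<^sub>P"
    and qs: "set qs = R - (\<Union>i\<in>{1..m}. pair_set m p rs i)"
    and gq: "greedy m p (map (\<lambda>i. {i}) qs) S\<^sub>P S"
    unfolding reassignment_def by blast
  have "set Ps = pair_set m p rs ` {1..m}"
    using mset_eq_setD[OF Ps] by (simp add: atLeastLessThanSuc_atLeastAtMost del: upt_Suc)
  moreover have "(\<Union>i\<in>{1..m}. pair_set m p rs i) \<subseteq> R"
  proof (rule UN_least)
    fix i assume "i \<in> {1..m}"
    then have "pair_set m p rs i \<subseteq> set rs"
      by (rule pair_set_subset)
    then show "pair_set m p rs i \<subseteq> R"
      unfolding rs by blast
  qed
  ultimately have "\<Union>(set Ps) \<union> set qs = R"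
    using qs by auto
  moreover have "dom S = dom S\<^sub>1 \<union> \<Union>(set Ps) \<union> set qs"
    using greedy_dom_ran(1)[OF gP] greedy_dom_ran(1)[OF gq] by simp
  ultimately have "dom S = {1..n}"
    using assms(1) by (simp add: Un_assoc)
  moreover have "ran S \<subseteq> {1..m}"
    using greedy_dom_ran(2)[OF gP] greedy_dom_ran(2)[OF gq] assms(2) by blast
  ultimately show ?thesis
    by (simp add: complete_schedules_def)
qed

lemma reassignment_makespan_le:
  assumes "dom S\<^sub>1 \<union> R = {1..n}" "\<And>j. \<not> exceeds m \<alpha> p n S\<^sub>1 j" "reassignment m \<alpha> p n R S\<^sub>1 S"
  shows "makespan m p S \<le> \<alpha> * OPT m p n"
proof -
  from assms(3) obtain rs Ps qs S\<^sub>P where rs: "distinct rs" "set rs = {i \<in> R. p i > (\<alpha> - 1) * L n}"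
      "sorted_wrt (\<lambda>x y. p x \<ge> p y) rs"
    and Ps: "mset Ps = mset (map (pair_set m p rs) [1..<Suc m])" "sorted_wrt (\<lambda>A B. sum p A \<ge> sum p B) Ps"
    and gP: "greedy m p Ps S\<^sub>1 S\<^sub>P"
    and qs: "set qs = R - (\<Union>i\<in>{1..m}. pair_set m p rs i)"
    and gq: "greedy m p (map (\<lambda>i. {i}) qs) S\<^sub>P S"
    unfolding reassignment_def by blast
  define C where "C = OPT m p n"
  have LC: "L n \<le> C" "0 \<le> C"
    using L_le_OPT OPT_nonneg by (auto simp: C_def)
  have R: "R \<subseteq> {1..n}" and dom1: "dom S\<^sub>1 \<subseteq> {1..n}"
    using assms(1) by auto
  have rs_large: "set rs \<subseteq> {i\<in>{1..n}. \<not> small n i}"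
    using rs(2) R by (auto simp: small_at_def)
  then have rs_n: "set rs \<subseteq> {1..n}"
    by blast
  have "length rs \<le> 2 * m"
    using card_mono[OF _ rs_large] card_large_le[of n] distinct_card[OF rs(1)] by simp
  have setPs: "set Ps = pair_set m p rs ` {1..m}"
    using mset_eq_setD[OF Ps(1)] by (simp add: atLeastLessThanSuc_atLeastAtMost del: upt_Suc)
  have PsB: "B \<subseteq> {1..n}" "sum p B \<le> C" "0 \<le> sum p B" if "B \<in> set Ps" for B
  proof -
    from that setPs obtain i where i: "i \<in> {1..m}" "B = pair_set m p rs i"
      by blast
    show "B \<subseteq> {1..n}"
      using pair_set_subset[OF i(1), of rs] rs_n i(2) by blast
    then show "0 \<le> sum p B"
      by (rule sum_p_nonneg)
    show "sum p B \<le> C"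
      unfolding C_def i(2) by (rule sum_pair_set_le_OPT[OF rs(1) rs_n rs(3) i(1)])
  qed
  have lenPs: "length Ps = m"
    using mset_eq_length[OF Ps(1)] by simp
  have "sum_list (map (sum p) Ps) = sum_list (map (sum p) (map (pair_set m p rs) [1..<Suc m]))"
    unfolding sum_mset_sum_list[symmetric] mset_map[of "sum p"] Ps(1) ..
  also have "\<dots> = (\<Sum>i=1..m. sum p (pair_set m p rs i))"
    by (simp add: comp_def sum_list_distinct_conv_sum_set atLeastLessThanSuc_atLeastAtMost del: upt_Suc)
  also have "\<dots> = sum p (\<Union>i\<in>{1..m}. pair_set m p rs i)"
  proof (rule sum.UNION_disjoint[symmetric])
    show "\<forall>i\<in>{1..m}. finite (pair_set m p rs i)"
      by (simp add: pair_set_def)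
    show "\<forall>i\<in>{1..m}. \<forall>k\<in>{1..m}. i \<noteq> k \<longrightarrow> pair_set m p rs i \<inter> pair_set m p rs k = {}"
      using pair_set_disjoint[OF rs(1)] by blast
  qed simp
  also have "\<dots> \<le> sum p {i\<in>{1..n}. \<not> small n i}"
  proof (rule sum_p_mono)
    show "(\<Union>i\<in>{1..m}. pair_set m p rs i) \<subseteq> {i\<in>{1..n}. \<not> small n i}"
      using order.trans[OF pair_set_subset rs_large] by (intro UN_least)
  qed auto
  \<comment> \<open>The sets are disjoint and contain only large jobs, whose sizes and the m *
    \<open>Ls n\<close> of the small jobs share the total processing time.\<close>
  finally have total: "real m * Ls n + (\<Sum>i<m. sum p (Ps ! i)) \<le> real m * C"
    using sum_large_le LC(1) mult_left_mono[OF LC(1), of "real m"]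
    by (simp add: sum_list_sum_nth lenPs atLeast0LessThan)
  define c where "c j = max (b j * Ls n) ((\<alpha> - 1) * L n)" for j
  have "(\<alpha> - 1) * L n \<le> (\<alpha> - 1) * C"
    using LC alpha_ge by (intro mult_left_mono) auto
  have cW: "c j \<le> \<alpha> * C" if "j \<in> {1..m}" for j
  proof -
    have "b j * Ls n \<le> \<alpha> * C"
      using beta_le[OF that] L_star_le_L[of n] L_star_nonneg[of n] LC alpha_ge
      by (intro mult_mono) auto
    moreover have "(\<alpha> - 1) * C \<le> \<alpha> * C"
      using LC(2) by (intro mult_right_mono) auto
    ultimately show ?thesis
      using \<open>(\<alpha> - 1) * L n \<le> (\<alpha> - 1) * C\<close> by (simp add: c_def)
  qed
  have loadP: "load p S\<^sub>P j \<le> \<alpha> * C" if "j \<in> {1..m}" for j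
  proof (rule greedy_sets_load_le[OF gP dom1, of "{}" 0 c])
    show "load p S\<^sub>1 j \<le> c j" if "j \<in> {1..m} - {}" for j
      using assms(2)[of j] that by (auto simp: exceeds_def c_def not_less le_max_iff_disj)
    show "c j + sum p (Ps ! i) \<le> \<alpha> * C" if ij: "i < length Ps" "j \<in> {1..Suc (0 + i)}" for i j
    proof -
      define x where "x = sum p (Ps ! i)"
      have x: "0 \<le> x" "x \<le> C"
        using PsB[of "Ps ! i"] ij(1) by (simp_all add: x_def)
      \<comment> \<open>The sets come in non-increasing order, so each of the first i + 1 has total
        at least x.\<close>
      have "real (Suc i) * x = (\<Sum>k<Suc i. x)"
        by simp
      also have "\<dots> \<le> (\<Sum>k<Suc i. sum p (Ps ! k))"
        unfolding x_def using sorted_wrt_nth_less[OF Ps(2), of _ i] ij(1)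
        by (intro sum_mono) (auto simp: less_Suc_eq)
      also have "\<dots> \<le> (\<Sum>k<m. sum p (Ps ! k))"
        using ij(1) lenPs PsB(3) by (intro sum_mono2) auto
      finally have "b j * Ls n + x \<le> \<alpha> * C"
        using total x ij lenPs by (intro beta_L_star_add_le[of j "Suc i"]) auto
      moreover have "(\<alpha> - 1) * L n + x \<le> \<alpha> * C"
        using \<open>(\<alpha> - 1) * L n \<le> (\<alpha> - 1) * C\<close> x(2) by (simp add: algebra_simps)
      ultimately show ?thesis
        by (simp add: c_def x_def)
    qed
  qed (use PsB cW lenPs that in auto)
  \<comment> \<open>A leftover large job is at most C / 3, which \<alpha> \<ge> 4/3 absorbs; any
    other leftover job is at most (\<alpha> - 1) * \<open>L n\<close>.\<close>
  have "L n + p x \<le> \<alpha> * C" if "x \<in> set qs" for x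
  proof (cases "x \<in> set rs")
    case True
    have "3 * p x \<le> C"
      unfolding C_def using qs that
      by (intro leftover_le_OPT[OF rs(1) rs_n rs(3) \<open>length rs \<le> 2 * m\<close> True]) blast
    moreover have "4/3 * C \<le> \<alpha> * C"
      using alpha_ge LC(2) by (rule mult_right_mono)
    ultimately show ?thesis
      using LC(1) by linarith
  next
    case False
    then have "p x \<le> (\<alpha> - 1) * L n"
      using that qs rs(2) by auto
    then show ?thesis
      using \<open>(\<alpha> - 1) * L n \<le> (\<alpha> - 1) * C\<close> LC(1) by (simp add: algebra_simps)
  qed
  then have "load p S j \<le> \<alpha> * C" if "j \<in> {1..m}" for j
  proof (intro greedy_load_le[OF gq _ _ loadP that])
    show "dom S\<^sub>P \<subseteq> {1..n}"
      unfolding greedy_dom_ran(1)[OF gP] using dom1 Union_least[of "set Ps", OF PsB(1)] by (rule Un_least)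
  qed (use R qs in auto)
  then show ?thesis
    using m_ge2 by (simp add: makespan_def C_def)
qed

end

theorem theorem1:
  fixes m n :: nat and p :: "nat \<Rightarrow> real"
  assumes "m \<ge> 2" and "\<forall>i\<in>{1..n}. p i > 0"
  shows "(\<exists>!\<alpha>. \<alpha> > 1 \<and> f_comp m \<alpha> = 1)
    \<and> (\<forall>t S. t < n \<and> arrival m (alpha m) p t S \<and> small_at m (alpha m) p (Suc t) (Suc t)
          \<longrightarrow> (\<exists>j. admissible m (alpha m) p S (Suc t) j))
    \<and> (\<exists>S R. ALG m (alpha m) p n S R)
    \<and> (\<forall>S R. ALG m (alpha m) p n S R \<longrightarrow>
          S \<in> complete_schedules m n
          \<and> makespan m p S \<le> alpha m * OPT m p n
          \<and> int (card R) \<le> (\<lceil>(2 - alpha m) / (alpha m - 1)\<^sup>2\<rceil> + 4) * int m)"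
proof -
  interpret migration_setting m n p "alpha m"
    using assms ex1_f_comp[of m] by unfold_locales auto
  have "\<exists>j. admissible m (alpha m) p S (Suc t) j" if "t < n" "arrival m (alpha m) p t S" for t S
    using ex_admissible[OF that(1) arrival_dom_ran(1)[OF that(2)]] .
  moreover have "S \<in> complete_schedules m n \<and> makespan m p S \<le> alpha m * OPT m p n
      \<and> int (card R) \<le> (\<lceil>(2 - alpha m) / (alpha m - 1)\<^sup>2\<rceil> + 4) * int m"
    if run: "ALG m (alpha m) p n S R" for S R
  proof -
    from run obtain S\<^sub>0 S\<^sub>1 where S0: "arrival m (alpha m) p n S\<^sub>0"
      and S1: "removal m (alpha m) p n S\<^sub>0 S\<^sub>1 R" "\<And>j. \<not> exceeds m (alpha m) p n S\<^sub>1 j"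
      and re: "reassignment m (alpha m) p n R S\<^sub>1 S"
      unfolding ALG_def by blast
    have S1_eq: "S\<^sub>1 = (\<lambda>i. if i \<in> R then None else S\<^sub>0 i)"
      by (rule removal_eq(2)[OF S1(1)])
    have "dom S\<^sub>1 \<union> R = dom S\<^sub>0 \<union> R"
      unfolding S1_eq by (auto simp: dom_def)
    then have dom: "dom S\<^sub>1 \<union> R = {1..n}"
      using removal_eq(1)[OF S1(1)] arrival_dom_ran(1)[OF S0] by (simp add: Un_absorb2)
    have "ran S\<^sub>1 \<subseteq> ran S\<^sub>0"
      unfolding S1_eq by (auto simp: ran_def split: if_splits)
    then have ran: "ran S\<^sub>1 \<subseteq> {1..m}"
      using arrival_dom_ran(2)[OF S0] by blast
    \<comment> \<open>Nonnegativity makes the natural number \<open>N\<close> agree with the integer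
      ceiling of the statement.\<close>
    have "0 \<le> \<lceil>(2 - alpha m) / (alpha m - 1)\<^sup>2\<rceil>"
      using N_pos unfolding N_def by linarith
    then have "int ((N + 4) * m) = (\<lceil>(2 - alpha m) / (alpha m - 1)\<^sup>2\<rceil> + 4) * int m"
      by (simp add: N_def)
    then show ?thesis
      using reassignment_complete[OF dom ran re] reassignment_makespan_le[OF dom S1(2) re]
        card_removed_le[OF S0 S1(1)] by (metis of_nat_le_iff)
  qed
  ultimately show ?thesis
    using ex1_f_comp(1)[OF assms(1)] ex_ALG by blast
qed

end
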